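(* Let $L$ be a field and let $\Gamma$ be a finite simplicial graph. Let $h_\Gamma$ denote the Cheeger constant of $\Gamma$, and let $h_V$ denote the Cheeger constant of the triple $(V,W,q)=(H^1(A(\Gamma),L),H^2(A(\Gamma),L),\smile)$. Then $h_\Gamma=h_V$.
   Context: A simplicial graph is an undirected graph with no multiple edges and no loops. The right-angled Artin group on a finite simplicial graph $\Gamma$ is $A(\Gamma)=\langle \mathrm{Vert}(\Gamma)\mid [v,w]=1 \text{ for every } \{v,w\}\in\mathrm{Edge}(\Gamma)\rangle$. $H^i(A(\Gamma),L)$ is group cohomology with trivial coefficients in the field $L$, and $\smile$ is the cup product $H^1(A(\Gamma),L)\times H^1(A(\Gamma),L)\to H^2(A(\Gamma),L)$. Graph Cheeger constant: for nonempty $A\subset\mathrm{Vert}(\Gamma)$, let $\partial A$ be the set of vertices not in $A$ that are adjacent to some vertex of $A$, and $h_A=|\partial A|/|A|$. Then $h_\Gamma=\min_A h_A$, the minimum over nonempty $A\subset \mathrm{Vert}(\Gamma)$ with $|A|\le |\mathrm{Vert}(\Gamma)|/2$. Cheeger constant of a triple: let $V$ be a finite dimensional $L$-vector space, $W$ an $L$-vector space, $q\colon V\times V\to W$ a symmetric or anti-symmetric bilinear pairing. For a subspace $F\subset V$ with $0<\dim F\le(\dim V)/2$, let $C=\{v\in V\mid q(f,v)=0 \text{ for all } f\in F\}$ and $$h_F=\frac{\dim V-\dim F-\dim C+\dim(C\cap F)}{\dim F}.$$ Then $h_V=\inf_F h_F$ over all subspaces $F$ with $0<\dim F\le(\dim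 V)/2$. If there are no admissible $A$ (respectively $F$), i.e. $\Gamma$ has at most one vertex, the minimum (respectively infimum) over the empty set is taken to be $+\infty$. *)

theory Defs
  imports
    "HOL-Algebra.QuotRing"
    "Jordan_Normal_Form.Missing_VectorSpace"
    "HOL-Library.Extended_Real"
begin

section \<open>Finite simplicial graphs and their Cheeger constant\<close>

record 'v simplicial_graph =
  Vert :: "'v set"
  Edge :: "'v set set"

locale fin_simplicial_graph =
  fixes \<Gamma> :: "'v simplicial_graph"
  assumes finite_Vert: "finite (Vert \<Gamma>)"
    and Edge_subset: "e \<in> Edge \<Gamma> \<Longrightarrow> e \<subseteq> Vert \<Gamma>"
    and Edge_card: "e \<in> Edge \<Gamma> \<Longrightarrow> card e = 2"

definition vertex_boundary :: "'v simplicial_graph \<Rightarrow> 'v set \<Rightarrow> 'v set" where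
  "vertex_boundary \<Gamma> A = {w \<in> Vert \<Gamma> - A. \<exists>v\<in>A. {v, w} \<in> Edge \<Gamma>}"

text \<open>Values are taken in \<^typ>\<open>ereal\<close>, where the infimum over the empty family is \<open>\<infinity>\<close>.
  For a finite graph the family below is finite, so the infimum is a minimum as soon as the
  family is nonempty.\<close>

definition graph_cheeger :: "'v simplicial_graph \<Rightarrow> ereal" where
  "graph_cheeger \<Gamma> =
     (INF A \<in> {A. A \<subseteq> Vert \<Gamma> \<and> A \<noteq> {} \<and> real (card A) \<le> real (card (Vert \<Gamma>)) / 2}.
        ereal (real (card (vertex_boundary \<Gamma> A)) / real (card A)))"


section \<open>Group presentations and right-angled Artin groups\<close>

text \<open>A letter \<open>(s, True)\<close> stands for the generator \<open>s\<close> and \<open>(s, False)\<close> for its inverse.\<close>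

type_synonym 's word = "('s \<times> bool) list"

definition words :: "'s set \<Rightarrow> 's word set" where
  "words S = lists (S \<times> UNIV)"

inductive_set presentation_cong :: "'s set \<Rightarrow> 's word set \<Rightarrow> ('s word \<times> 's word) set"
  for S :: "'s set" and R :: "'s word set"
where
  refl: "u \<in> words S \<Longrightarrow> (u, u) \<in> presentation_cong S R"
| sym: "(u, v) \<in> presentation_cong S R \<Longrightarrow> (v, u) \<in> presentation_cong S R"
| trans: "(u, v) \<in> presentation_cong S R \<Longrightarrow> (v, w) \<in> presentation_cong S R
    \<Longrightarrow> (u, w) \<in> presentation_cong S R"
| cancel: "u \<in> words S \<Longrightarrow> v \<in> words S \<Longrightarrow> s \<in> S
    \<Longrightarrow> (u @ [(s, b), (s, \<not> b)] @ v, u @ v) \<in> presentation_cong S R"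
| relator: "u \<in> words S \<Longrightarrow> v \<in> words S \<Longrightarrow> r \<in> R
    \<Longrightarrow> (u @ r @ v, u @ v) \<in> presentation_cong S R"

text \<open>The group \<open>\<langle>S | R\<rangle>\<close> for a set of relators \<open>R \<subseteq> words S\<close>.\<close>

definition presented_group :: "'s set \<Rightarrow> 's word set \<Rightarrow> 's word set monoid" where
  "presented_group S R =
     \<lparr> carrier = words S // presentation_cong S R,
       mult = (\<lambda>X Y. \<Union>u\<in>X. \<Union>v\<in>Y. presentation_cong S R `` {u @ v}),
       one = presentation_cong S R `` {[]} \<rparr>"

definition commutator_word :: "'s \<Rightarrow> 's \<Rightarrow> 's word" where
  "commutator_word v w = [(v, True), (w, True), (v, False), (w, False)]"

definition raag :: "'v simplicial_graph \<Rightarrow> 'v word set monoid" where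
  "raag \<Gamma> = presented_group (Vert \<Gamma>) {commutator_word v w | v w. {v, w} \<in> Edge \<Gamma>}"


section \<open>Group cohomology with trivial coefficients\<close>

text \<open>Cohomology of the group \<open>G\<close> with trivial coefficients in the field \<open>L\<close>, computed by the
  inhomogeneous bar complex: \<open>n\<close>-cochains are the functions from \<open>n\<close>-tuples of elements of \<open>G\<close>
  to \<open>L\<close> (extensional, as in \<^const>\<open>ring.func_space\<close>).\<close>

definition tuples :: "('g, 'a) monoid_scheme \<Rightarrow> nat \<Rightarrow> 'g list set" where
  "tuples G n = {xs. length xs = n \<and> set xs \<subseteq> carrier G}"

definition cochains ::
  "('l, 'm) ring_scheme \<Rightarrow> ('g, 'a) monoid_scheme \<Rightarrow> nat \<Rightarrow> ('l, 'g list \<Rightarrow> 'l) module" where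
  "cochains L G n = ring.func_space L (tuples G n)"

definition merge_at :: "('g, 'a) monoid_scheme \<Rightarrow> nat \<Rightarrow> 'g list \<Rightarrow> 'g list" where
  "merge_at G i xs = take i xs @ [xs ! i \<otimes>\<^bsub>G\<^esub> xs ! Suc i] @ drop (i + 2) xs"

text \<open>\<open>(\<delta>f)(g\<^sub>0,\<dots>,g\<^sub>n) = f(g\<^sub>1,\<dots>,g\<^sub>n) + \<Sum>\<^sub>i\<^sub><\<^sub>n (-1)\<^sup>i\<^sup>+\<^sup>1 f(g\<^sub>0,\<dots>,g\<^sub>i g\<^sub>i\<^sub>+\<^sub>1,\<dots>,g\<^sub>n)
  + (-1)\<^sup>n\<^sup>+\<^sup>1 f(g\<^sub>0,\<dots>,g\<^sub>n\<^sub>-\<^sub>1)\<close>; there is no action in the first term since the coefficients are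
  trivial.\<close>

definition coboundary ::
  "('l, 'm) ring_scheme \<Rightarrow> ('g, 'a) monoid_scheme \<Rightarrow> nat \<Rightarrow> ('g list \<Rightarrow> 'l) \<Rightarrow> ('g list \<Rightarrow> 'l)" where
  "coboundary L G n f =
     (\<lambda>xs \<in> tuples G (Suc n).
        f (tl xs)
        \<oplus>\<^bsub>L\<^esub> (\<Oplus>\<^bsub>L\<^esub>i\<in>{..<n}. (\<ominus>\<^bsub>L\<^esub> \<one>\<^bsub>L\<^esub>) [^]\<^bsub>L\<^esub> Suc i \<otimes>\<^bsub>L\<^esub> f (merge_at G i xs))
        \<oplus>\<^bsub>L\<^esub> (\<ominus>\<^bsub>L\<^esub> \<one>\<^bsub>L\<^esub>) [^]\<^bsub>L\<^esub> Suc n \<otimes>\<^bsub>L\<^esub> f (butlast xs))"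

definition cocycles ::
  "('l, 'm) ring_scheme \<Rightarrow> ('g, 'a) monoid_scheme \<Rightarrow> nat \<Rightarrow> ('l, 'g list \<Rightarrow> 'l) module" where
  "cocycles L G n = (cochains L G n)
     \<lparr>carrier := {f \<in> carrier (cochains L G n). coboundary L G n f = \<zero>\<^bsub>cochains L G (Suc n)\<^esub>}\<rparr>"

definition coboundaries ::
  "('l, 'm) ring_scheme \<Rightarrow> ('g, 'a) monoid_scheme \<Rightarrow> nat \<Rightarrow> ('g list \<Rightarrow> 'l) set" where
  "coboundaries L G n =
     (case n of 0 \<Rightarrow> {\<zero>\<^bsub>cochains L G 0\<^esub>}
      | Suc m \<Rightarrow> coboundary L G m ` carrier (cochains L G m))"

text \<open>The quotient of a module by a submodule, with cosets as elements. The ring multiplication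
  fields of a module record carry no information and are filled with the zero element, as in
  \<^const>\<open>ring.func_space\<close>.\<close>

definition quotient_module ::
  "('l, 'x, 'k) module_scheme \<Rightarrow> 'x set \<Rightarrow> ('l, 'x set) module" where
  "quotient_module M N =
     \<lparr> carrier = a_rcosets\<^bsub>M\<^esub> N,
       mult = (\<lambda>X Y. N),
       one = N,
       zero = N,
       add = (\<lambda>X Y. X <+>\<^bsub>M\<^esub> Y),
       smult = (\<lambda>c X. \<Union>x\<in>X. N +>\<^bsub>M\<^esub> (c \<odot>\<^bsub>M\<^esub> x)) \<rparr>"

definition cohomology ::
  "('l, 'm) ring_scheme \<Rightarrow> ('g, 'a) monoid_scheme \<Rightarrow> nat \<Rightarrow> ('l, ('g list \<Rightarrow> 'l) set) module" where
  "cohomology L G n = quotient_module (cocycles L G n) (coboundaries L G n)"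

definition cup_cochain ::
  "('l, 'm) ring_scheme \<Rightarrow> ('g, 'a) monoid_scheme \<Rightarrow> nat \<Rightarrow> nat
    \<Rightarrow> ('g list \<Rightarrow> 'l) \<Rightarrow> ('g list \<Rightarrow> 'l) \<Rightarrow> ('g list \<Rightarrow> 'l)" where
  "cup_cochain L G p q a b =
     (\<lambda>xs \<in> tuples G (p + q). a (take p xs) \<otimes>\<^bsub>L\<^esub> b (drop p xs))"

text \<open>The cup product \<open>H\<^sup>p \<times> H\<^sup>q \<rightarrow> H\<^sup>p\<^sup>+\<^sup>q\<close>. The union is over all choices of representatives,
  which all give the same coset (compare \<^const>\<open>rcoset_mult\<close>).\<close>

definition cup ::
  "('l, 'm) ring_scheme \<Rightarrow> ('g, 'a) monoid_scheme \<Rightarrow> nat \<Rightarrow> nat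
    \<Rightarrow> ('g list \<Rightarrow> 'l) set \<Rightarrow> ('g list \<Rightarrow> 'l) set \<Rightarrow> ('g list \<Rightarrow> 'l) set" where
  "cup L G p q x y =
     (\<Union>a\<in>x. \<Union>b\<in>y. coboundaries L G (p + q) +>\<^bsub>cocycles L G (p + q)\<^esub> cup_cochain L G p q a b)"


section \<open>The Cheeger constant of a triple\<close>

locale pairing =
  V: vectorspace K V + W: vectorspace K W
  for K :: "('l, 'm) ring_scheme"
    and V :: "('l, 'x, 'c) module_scheme"
    and W :: "('l, 'y, 'd) module_scheme" +
  fixes q :: "'x \<Rightarrow> 'x \<Rightarrow> 'y"
  assumes fin_dim: "V.fin_dim"
    and closed: "u \<in> carrier V \<Longrightarrow> v \<in> carrier V \<Longrightarrow> q u v \<in> carrier W"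
    and add_left: "u \<in> carrier V \<Longrightarrow> u' \<in> carrier V \<Longrightarrow> v \<in> carrier V
      \<Longrightarrow> q (u \<oplus>\<^bsub>V\<^esub> u') v = q u v \<oplus>\<^bsub>W\<^esub> q u' v"
    and add_right: "u \<in> carrier V \<Longrightarrow> v \<in> carrier V \<Longrightarrow> v' \<in> carrier V
      \<Longrightarrow> q u (v \<oplus>\<^bsub>V\<^esub> v') = q u v \<oplus>\<^bsub>W\<^esub> q u v'"
    and smult_left: "c \<in> carrier K \<Longrightarrow> u \<in> carrier V \<Longrightarrow> v \<in> carrier V
      \<Longrightarrow> q (c \<odot>\<^bsub>V\<^esub> u) v = c \<odot>\<^bsub>W\<^esub> q u v"
    and smult_right: "c \<in> carrier K \<Longrightarrow> u \<in> carrier V \<Longrightarrow> v \<in> carrier V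
      \<Longrightarrow> q u (c \<odot>\<^bsub>V\<^esub> v) = c \<odot>\<^bsub>W\<^esub> q u v"
    and symmetric_or_antisymmetric:
      "(\<forall>u\<in>carrier V. \<forall>v\<in>carrier V. q u v = q v u)
        \<or> (\<forall>u\<in>carrier V. \<forall>v\<in>carrier V. q u v = \<ominus>\<^bsub>W\<^esub> q v u)"
begin

definition orth :: "'x set \<Rightarrow> 'x set" where
  "orth F = {v \<in> carrier V. \<forall>f\<in>F. q f v = \<zero>\<^bsub>W\<^esub>}"

abbreviation sdim :: "'x set \<Rightarrow> real" where
  "sdim F \<equiv> real (vectorspace.dim K (V.vs F))"

definition cheeger_quotient :: "'x set \<Rightarrow> real" where
  "cheeger_quotient F =
     (sdim (carrier V) - sdim F - sdim (orth F) + sdim (orth F \<inter> F)) / sdim F"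

definition cheeger :: ereal where
  "cheeger =
     (INF F \<in> {F. VectorSpace.subspace K F V \<and> 0 < sdim F \<and> sdim F \<le> sdim (carrier V) / 2}.
        ereal (cheeger_quotient F))"

end

end

theory Submission
  imports Defs
begin

text \<open>Let \<open>A\<close> be the Artin group of \<open>\<Gamma>\<close>. A class in \<open>H\<^sup>1(A, L)\<close> is an additive character of \<open>A\<close>, and since the
relators are commutators a character may take arbitrary values on the generators: \<open>H\<^sup>1(A, L)\<close> has
coordinates indexed by the vertices (\<open>gen_values_coordinates\<close>). In these coordinates the cup product
\<open>a \<smile> b\<close> vanishes iff \<open>a\<^sub>v b\<^sub>w = a\<^sub>w b\<^sub>v\<close> for every edge \<open>{v, w}\<close> (\<open>cup_eq_zero_iff_minors\<close>). Indeed
\<open>a \<smile> b = \<delta>f\<close> means \<open>f(gh) = f(g) + f(h) - a(g) b(h)\<close>. If such an \<open>f\<close> exists, comparing \<open>f(gh)\<close> with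
\<open>f(hg)\<close> for the commuting generators \<open>g\<close>, \<open>h\<close> at the ends of an edge gives the equation. Conversely the
equations say that the elements \<open>(a\<^sub>v, b\<^sub>v, 0)\<close> of a Heisenberg group satisfy the relations of \<open>A\<close>, and
the last coordinate of the resulting homomorphism is such an \<open>f\<close>.

Both Cheeger constants depend only on this description of when \<open>q(x, y) = 0\<close>, so what is left is linear
algebra on the graph (\<open>cheeger_eq_graph_cheeger\<close>). For a vertex set \<open>X\<close>, the coordinate subspace of
vectors supported on \<open>X\<close> has Cheeger quotient \<open>|\<partial>X| / |X|\<close>, whence \<open>h\<^sub>V \<le> h\<^sub>\<Gamma>\<close>.

For the other inequality a subspace \<open>F\<close> with orthogonal \<open>C\<close> has to be traded for a vertex set \<open>X\<close> with
\<open>|X| = dim F\<close> and \<open>|\<partial>X| \<le> dim V - dim F - dim C + dim (C \<inter> F)\<close> (\<open>exists_vertex_set_of_subspace\<close>). Let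
\<open>S\<close> and \<open>T\<close> be the sets of vertices on which some vector of \<open>F\<close>, respectively of \<open>C\<close>, is nonzero. Any
\<open>X \<subseteq> S\<close> with \<open>|X| = dim F\<close> and \<open>|X \<inter> T| = dim (C \<inter> F)\<close> will do. Such a set exists: vectors of
\<open>C \<inter> F\<close> are supported on \<open>S \<inter> T\<close>, and the edge equations show that a vector of \<open>F\<close> vanishing on
\<open>S - T\<close> lies in \<open>C\<close>, so that \<open>dim F - dim (C \<inter> F) \<le> |S - T|\<close>. For the estimate, let \<open>w \<in> \<partial>X\<close> be adjacent
to \<open>v \<in> X\<close> and choose \<open>f \<in> F\<close> with \<open>f\<^sub>v \<noteq> 0\<close>; the equation \<open>f\<^sub>v c\<^sub>w = f\<^sub>w c\<^sub>v\<close> shows that \<open>c\<^sub>v = 0\<close> forces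
\<open>c\<^sub>w = 0\<close> for \<open>c \<in> C\<close>. Hence a vector of \<open>C\<close> is determined by its values on \<open>T - \<partial>X\<close>, that is
\<open>dim C \<le> |T| - |T \<inter> \<partial>X|\<close>. The rest of \<open>\<partial>X\<close> avoids \<open>T\<close> and \<open>X\<close>, so it has at most
\<open>|Vert \<Gamma>| - |T| - (dim F - dim (C \<inter> F))\<close> elements. Adding the two bounds gives the claim.\<close>

section \<open>Subspaces of a vector space with coordinates\<close>

lemma (in vectorspace) dim_eq_0_subset_zero:
  assumes "carrier V \<subseteq> {\<zero>\<^bsub>V\<^esub>}"
  shows "dim = 0"
proof -
  have "span {} = carrier V"
    using assms span_empty M.zero_closed by auto
  then have "gen_set {}" by simp
  from gen_ge_dim[OF _ _ this] show ?thesis by simp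
qed

text \<open>A maximal linearly independent subset of the subspace is a basis of it; its size is bounded because
  it is still independent in the whole space.\<close>

lemma (in vectorspace) subspace_fin_dim:
  assumes fd: "fin_dim" and U: "VectorSpace.subspace K U V"
  shows "vectorspace.fin_dim K (vs U)" "vectorspace.dim K (vs U) \<le> dim"
proof -
  interpret U: vectorspace K "vs U" by (rule subspace_is_vs[OF U])
  have sm: "submodule K U V" using U by simp
  have UV: "U \<subseteq> carrier V" using sm by (simp add: submodule_def)
  have P: "finite A \<and> card A \<le> dim" if "A \<subseteq> U \<and> U.lin_indpt A" for A
  proof -
    have "lin_indpt A" using span_li_not_depend(2)[OF _ sm] that by blast
    then show ?thesis using li_le_dim[OF fd, of A] that UV by blast
  qed
  have "U.lin_indpt {}" by (simp add: U.lin_dep_def)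
  then obtain B where B: "finite B" "maximal B (\<lambda>S. S \<subseteq> U \<and> U.lin_indpt S)"
    using maximal_exists[of "\<lambda>S. S \<subseteq> U \<and> U.lin_indpt S", OF P] by blast
  then have b: "U.basis B" using U.max_li_is_basis by simp
  then show "U.fin_dim" using B(1) by (auto simp: U.basis_def U.fin_dim_def)
  have "card B \<le> dim" using P B(2) by (auto simp: maximal_def)
  then show "U.dim \<le> dim" using U.dim_basis[OF B(1) b] by simp
qed

lemma (in vectorspace) subspace_dim_mono:
  assumes fd: "fin_dim" and U: "VectorSpace.subspace K U V" and U': "VectorSpace.subspace K U' V" and UU': "U \<subseteq> U'"
  shows "vectorspace.dim K (vs U) \<le> vectorspace.dim K (vs U')"
proof -
  interpret U': vectorspace K "vs U'" by (rule subspace_is_vs[OF U'])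
  have "VectorSpace.subspace K U (vs U')"
    using U U' UU' subspace_is_vs[OF U'] by (auto simp: VectorSpace.subspace_def submodule_def U'.module_axioms)
  from U'.subspace_fin_dim(2)[OF subspace_fin_dim(1)[OF fd U'] this] show ?thesis by simp
qed

lemma (in vectorspace) subspace_Int:
  assumes "VectorSpace.subspace K U V" "VectorSpace.subspace K U' V"
  shows "VectorSpace.subspace K (U \<inter> U') V"
  using assms by (auto simp: VectorSpace.subspace_def submodule_def)

context field
begin

lemma func_space_vectorspace: "vectorspace R (func_space S)"
  using func_space_is_module field_axioms by (auto simp: vectorspace_def)

lemma func_space_simps:
  "carrier (func_space S) = S \<rightarrow>\<^sub>E carrier R"
  "f \<oplus>\<^bsub>func_space S\<^esub> g = (\<lambda>v\<in>S. f v \<oplus> g v)"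
  "\<zero>\<^bsub>func_space S\<^esub> = (\<lambda>v\<in>S. \<zero>)"
  "c \<odot>\<^bsub>func_space S\<^esub> f = (\<lambda>v\<in>S. c \<otimes> f v)"
  by (simp_all add: func_space_def)

text \<open>These functions form the standard basis of \<open>func_space S\<close> for finite \<open>S\<close>.\<close>

definition unit_fun :: "'i set \<Rightarrow> 'i \<Rightarrow> ('i \<Rightarrow> 'a)" where
  "unit_fun S i = (\<lambda>j\<in>S. if j = i then \<one> else \<zero>)"

lemma lincomb_unit_fun:
  assumes fin: "finite J" and J: "J \<subseteq> S" and a: "a \<in> unit_fun S ` J \<rightarrow> carrier R"
  shows "module.lincomb (func_space S) a (unit_fun S ` J)
    = (\<lambda>j\<in>S. if j \<in> J then a (unit_fun S j) else \<zero>)"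
proof -
  interpret F: vectorspace R "func_space S" by (rule func_space_vectorspace)
  show ?thesis using fin J a
  proof (induct J)
    case empty
    then show ?case by (simp add: func_space_simps)
  next
    case (insert i J)
    have ni: "unit_fun S i \<notin> unit_fun S ` J"
    proof
      assume "unit_fun S i \<in> unit_fun S ` J"
      then obtain j where "j \<in> J" "unit_fun S i i = unit_fun S j i" by auto
      then show False using insert by (auto simp: unit_fun_def split: if_splits)
    qed
    have c: "unit_fun S j \<in> carrier (func_space S)" for j
      by (auto simp: func_space_simps unit_fun_def)
    have ap: "a (unit_fun S j) \<in> carrier R" if "j \<in> insert i J" for j
      using insert(5) that by blast
    have "F.lincomb a (unit_fun S ` insert i J)
        = a (unit_fun S i) \<odot>\<^bsub>func_space S\<^esub> unit_fun S i \<oplus>\<^bsub>func_space S\<^esub> F.lincomb a (unit_fun S ` J)"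
      using F.lincomb_insert2[of "unit_fun S ` J" a "unit_fun S i"] insert c ni by auto
    also have "F.lincomb a (unit_fun S ` J) = (\<lambda>j\<in>S. if j \<in> J then a (unit_fun S j) else \<zero>)"
      using insert by auto
    also have "a (unit_fun S i) \<odot>\<^bsub>func_space S\<^esub> unit_fun S i \<oplus>\<^bsub>func_space S\<^esub> \<dots>
      = (\<lambda>j\<in>S. if j \<in> insert i J then a (unit_fun S j) else \<zero>)"
      using ap insert(2) by (auto simp: func_space_simps unit_fun_def fun_eq_iff restrict_def)
    finally show ?case .
  qed
qed

lemma func_space_finite_dim:
  assumes fin: "finite S"
  shows "vectorspace.fin_dim R (func_space S)" "vectorspace.dim R (func_space S) = card S"
proof -
  interpret F: vectorspace R "func_space S" by (rule func_space_vectorspace)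
  let ?B = "unit_fun S ` S"
  have inj: "inj_on (unit_fun S) S"
  proof
    fix i j assume "i \<in> S" "j \<in> S" "unit_fun S i = unit_fun S j"
    then have "unit_fun S i i = unit_fun S j i" "i \<in> S" by auto
    then show "i = j" by (auto simp: unit_fun_def split: if_splits)
  qed
  have BC: "?B \<subseteq> carrier (func_space S)" by (auto simp: func_space_simps unit_fun_def)
  have li: "F.lin_indpt ?B"
  proof (rule F.finite_lin_indpt2)
    fix a assume a: "a \<in> ?B \<rightarrow> carrier R" and z: "F.lincomb a ?B = \<zero>\<^bsub>func_space S\<^esub>"
    have "a (unit_fun S j) = \<zero>" if "j \<in> S" for j
      using fun_cong[OF z, of j] that unfolding lincomb_unit_fun[OF fin subset_refl a]
      by (simp add: func_space_simps)
    then show "\<forall>v\<in>?B. a v = \<zero>" by auto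
  qed (use fin BC in auto)
  have "f \<in> F.span ?B" if f: "f \<in> carrier (func_space S)" for f
  proof -
    let ?a = "\<lambda>b. f (inv_into S (unit_fun S) b)"
    have a: "?a \<in> ?B \<rightarrow> carrier R" using f inj by (auto simp: func_space_simps)
    have "F.lincomb ?a ?B = f"
      unfolding lincomb_unit_fun[OF fin subset_refl a]
      using f inj by (auto simp: func_space_simps fun_eq_iff PiE_def extensional_def)
    then have "f = F.lincomb ?a ?B" by simp
    with a fin show ?thesis unfolding F.span_def
      by (intro CollectI exI[of _ ?a] exI[of _ ?B]) simp
  qed
  then have "F.basis ?B"
    using li BC F.span_is_subset2[OF BC] by (auto simp: F.basis_def)
  then show "F.fin_dim" "F.dim = card S"
    using F.dim_basis[of ?B] fin card_image[OF inj] BC by (auto simp: F.basis_def F.fin_dim_def)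
qed

end

lemma (in linear_map) inverse_linear:
  assumes inj: "inj_on T (carrier V)" and surj: "T ` carrier V = carrier W"
  shows "linear_map K W V (inv_into (carrier V) T)"
proof -
  have gc: "inv_into (carrier V) T y \<in> carrier V" if "y \<in> carrier W" for y
    using that surj by (metis inv_into_into)
  have fg: "T (inv_into (carrier V) T y) = y" if "y \<in> carrier W" for y
    using that surj by (metis f_inv_into_f)
  have eqI: "inv_into (carrier V) T y = x" if "x \<in> carrier V" "T x = y" for x y
    using that inj by auto
  have "Module.module K V" "Module.module K W"
    using V.vectorspace_axioms W.vectorspace_axioms by (simp_all add: vectorspace_def)
  then have "mod_hom K W V (inv_into (carrier V) T)"
    unfolding mod_hom_def mod_hom_axioms_def LinearCombinations.module_hom_def
    by (auto simp: gc fg T_add T_smult intro!: eqI)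
  then show ?thesis
    by (simp add: linear_map_def V.vectorspace_axioms W.vectorspace_axioms)
qed

text \<open>An isomorphism from \<open>V\<close> to the space of functions \<open>I \<rightarrow> K\<close>, given by its coordinate functionals. The
  values of \<open>T x\<close> outside \<open>I\<close> are unspecified, which spares restricting functions to \<open>I\<close> when \<open>T\<close> is
  defined by evaluation.\<close>

locale coordinates =
  V: vectorspace K V
  for K :: "('l, 'm) ring_scheme" and V :: "('l, 'x, 'c) module_scheme" +
  fixes I :: "'i set" and T :: "'x \<Rightarrow> 'i \<Rightarrow> 'l"
  assumes finite_I: "finite I"
    and T_closed: "x \<in> carrier V \<Longrightarrow> i \<in> I \<Longrightarrow> T x i \<in> carrier K"
    and T_add: "x \<in> carrier V \<Longrightarrow> y \<in> carrier V \<Longrightarrow> i \<in> I \<Longrightarrow> T (x \<oplus>\<^bsub>V\<^esub> y) i = T x i \<oplus>\<^bsub>K\<^esub> T y i"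
    and T_smult: "c \<in> carrier K \<Longrightarrow> x \<in> carrier V \<Longrightarrow> i \<in> I \<Longrightarrow> T (c \<odot>\<^bsub>V\<^esub> x) i = c \<otimes>\<^bsub>K\<^esub> T x i"
    and T_inj: "x \<in> carrier V \<Longrightarrow> (\<And>i. i \<in> I \<Longrightarrow> T x i = \<zero>\<^bsub>K\<^esub>) \<Longrightarrow> x = \<zero>\<^bsub>V\<^esub>"
    and T_surj: "f \<in> I \<rightarrow> carrier K \<Longrightarrow> \<exists>x\<in>carrier V. \<forall>i\<in>I. T x i = f i"
begin

abbreviation subdim :: "'x set \<Rightarrow> nat" where
  "subdim U \<equiv> vectorspace.dim K (V.vs U)"

text \<open>The vectors supported on \<open>J\<close>, i.e. the span of the dual basis vectors indexed by \<open>J\<close>.\<close>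

definition coord_subspace :: "'i set \<Rightarrow> 'x set" where
  "coord_subspace J = {x \<in> carrier V. \<forall>i\<in>I - J. T x i = \<zero>\<^bsub>K\<^esub>}"

lemma restriction_linear:
  assumes U: "VectorSpace.subspace K U V" and J: "J \<subseteq> I"
  shows "linear_map K (V.vs U) (ring.func_space K J) (\<lambda>x. \<lambda>i\<in>J. T x i)"
proof -
  interpret U: vectorspace K "V.vs U" by (rule V.subspace_is_vs[OF U])
  interpret F: vectorspace K "V.func_space J" by (rule V.func_space_vectorspace)
  have UV: "U \<subseteq> carrier V" using V.is_module[OF U] by (simp add: submodule_def)
  have JI: "i \<in> I" if "i \<in> J" for i using J that by blast
  have UC: "x \<in> carrier V" if "x \<in> U" for x using UV that by blast
  have "mod_hom K (V.vs U) (V.func_space J) (\<lambda>x. \<lambda>i\<in>J. T x i)"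
    unfolding mod_hom_def mod_hom_axioms_def LinearCombinations.module_hom_def
    by (simp add: U.module_axioms F.module_axioms V.func_space_simps UC JI T_closed T_add T_smult
        cong: restrict_cong)
  then show ?thesis
    by (simp add: linear_map_def U.vectorspace_axioms F.vectorspace_axioms)
qed

lemma T_zero: "i \<in> I \<Longrightarrow> T \<zero>\<^bsub>V\<^esub> i = \<zero>\<^bsub>K\<^esub>"
  using T_smult[of "\<zero>\<^bsub>K\<^esub>" "\<zero>\<^bsub>V\<^esub>" i] T_closed[of "\<zero>\<^bsub>V\<^esub>" i] by simp

lemma coord_subspace: "VectorSpace.subspace K (coord_subspace J) V"
  unfolding VectorSpace.subspace_def coord_subspace_def submodule_def
  using T_add T_smult T_zero V.module_axioms V.vectorspace_axioms by auto

lemma carrier_subspace: "VectorSpace.subspace K (carrier V) V"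
  by (simp add: VectorSpace.subspace_def submodule_def V.module_axioms V.vectorspace_axioms)

lemma coord_bij:
  assumes J: "J \<subseteq> I"
  shows "inj_on (\<lambda>x. \<lambda>i\<in>J. T x i) (coord_subspace J)"
    "(\<lambda>x. \<lambda>i\<in>J. T x i) ` coord_subspace J = carrier (ring.func_space K J)"
proof -
  interpret L: linear_map K "V.vs (coord_subspace J)" "V.func_space J" "\<lambda>x. \<lambda>i\<in>J. T x i"
    by (rule restriction_linear[OF coord_subspace J])
  have inj0: "x = \<zero>\<^bsub>V\<^esub>" if x: "x \<in> coord_subspace J" and z: "(\<lambda>i\<in>J. T x i) = \<zero>\<^bsub>V.func_space J\<^esub>" for x
  proof (rule T_inj)
    show "x \<in> carrier V" using x by (simp add: coord_subspace_def)
    fix i assume "i \<in> I"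
    then show "T x i = \<zero>\<^bsub>K\<^esub>"
      using x fun_cong[OF z, of i] by (cases "i \<in> J") (auto simp: coord_subspace_def V.func_space_simps)
  qed
  have "\<zero>\<^bsub>V\<^esub> \<in> coord_subspace J" by (simp add: coord_subspace_def T_zero)
  then have "L.kerT = {\<zero>\<^bsub>V\<^esub>}"
    using L.T0_is_0 by (auto simp: L.ker_def intro!: inj0)
  then show "inj_on (\<lambda>x. \<lambda>i\<in>J. T x i) (coord_subspace J)"
    using L.Ke0_imp_inj by simp
  show "(\<lambda>x. \<lambda>i\<in>J. T x i) ` coord_subspace J = carrier (ring.func_space K J)"
  proof
    show "(\<lambda>x. \<lambda>i\<in>J. T x i) ` coord_subspace J \<subseteq> carrier (V.func_space J)"
      using T_closed J by (auto simp: coord_subspace_def V.func_space_simps)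
    show "carrier (V.func_space J) \<subseteq> (\<lambda>x. \<lambda>i\<in>J. T x i) ` coord_subspace J"
    proof
      fix f assume f: "f \<in> carrier (V.func_space J)"
      have "(\<lambda>i. if i \<in> J then f i else \<zero>\<^bsub>K\<^esub>) \<in> I \<rightarrow> carrier K"
        using f by (auto simp: V.func_space_simps)
      from T_surj[OF this] obtain x where x: "x \<in> carrier V"
        "\<forall>i\<in>I. T x i = (if i \<in> J then f i else \<zero>\<^bsub>K\<^esub>)" by blast
      have "(\<lambda>i\<in>J. T x i) = f"
        using x f J by (auto simp: V.func_space_simps fun_eq_iff PiE_def extensional_def)
      moreover have "x \<in> coord_subspace J" using x by (simp add: coord_subspace_def)
      ultimately show "f \<in> (\<lambda>x. \<lambda>i\<in>J. T x i) ` coord_subspace J" by blast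
    qed
  qed
qed

text \<open>The function space is finite dimensional, and the inverse of the coordinate isomorphism maps it
  onto \<open>V\<close>.\<close>

lemma finite_dim: "V.fin_dim"
proof -
  have car: "coord_subspace I = carrier V" by (auto simp: coord_subspace_def)
  interpret L: linear_map K V "V.func_space I" "\<lambda>x. \<lambda>i\<in>I. T x i"
    using restriction_linear[OF carrier_subspace subset_refl] by simp
  note bij = coord_bij[OF subset_refl, unfolded car]
  from L.inverse_linear[OF bij]
  interpret G: linear_map K "V.func_space I" V "inv_into (carrier V) (\<lambda>x. \<lambda>i\<in>I. T x i)" .
  show ?thesis
    using G.rank_nullity_main(2)[OF V.func_space_finite_dim(1)[OF finite_I]]
      inv_into_image_cancel[OF bij(1) subset_refl] by (simp add: bij(2))
qed

lemma dim_coord_subspace: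
  assumes J: "J \<subseteq> I"
  shows "subdim (coord_subspace J) = card J"
proof -
  interpret L: linear_map K "V.vs (coord_subspace J)" "V.func_space J" "\<lambda>x. \<lambda>i\<in>J. T x i"
    by (rule restriction_linear[OF coord_subspace J])
  show ?thesis
    using L.dim_eq V.subspace_fin_dim(1)[OF finite_dim coord_subspace, of J] coord_bij[OF J]
      V.func_space_finite_dim(2)[of J] finite_subset[OF J finite_I] by simp
qed

lemma dim_carrier: "subdim (carrier V) = card I" "V.dim = card I"
  using dim_coord_subspace[OF subset_refl] by (simp_all add: coord_subspace_def)

text \<open>Rank-nullity for the restriction \<open>U \<rightarrow> (J \<rightarrow> K)\<close>, whose image has dimension at most \<open>|J|\<close>.\<close>

lemma dim_le_card_plus_kernel:
  assumes U: "VectorSpace.subspace K U V" and J: "J \<subseteq> I"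
  shows "subdim U \<le> card J + subdim (U \<inter> coord_subspace (I - J))"
proof -
  interpret L: linear_map K "V.vs U" "V.func_space J" "\<lambda>x. \<lambda>i\<in>J. T x i"
    by (rule restriction_linear[OF U J])
  have UV: "U \<subseteq> carrier V" using V.is_module[OF U] by (simp add: submodule_def)
  have ker: "L.kerT = U \<inter> coord_subspace (I - J)"
  proof (intro equalityI subsetI)
    fix x assume "x \<in> L.kerT"
    then have x: "x \<in> U" "(\<lambda>i\<in>J. T x i) = (\<lambda>i\<in>J. \<zero>\<^bsub>K\<^esub>)"
      by (simp_all add: L.ker_def V.func_space_simps)
    have "T x i = \<zero>\<^bsub>K\<^esub>" if "i \<in> J" for i using fun_cong[OF x(2), of i] that by simp
    then show "x \<in> U \<inter> coord_subspace (I - J)" using x(1) UV by (auto simp: coord_subspace_def)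
  next
    fix x assume x: "x \<in> U \<inter> coord_subspace (I - J)"
    then have "(\<lambda>i\<in>J. T x i) = (\<lambda>i\<in>J. \<zero>\<^bsub>K\<^esub>)"
      using J by (intro restrict_ext) (auto simp: coord_subspace_def)
    then show "x \<in> L.kerT" using x by (simp add: L.ker_def V.func_space_simps)
  qed
  have "vectorspace.dim K (L.W.vs L.imT) \<le> card J"
    using L.W.subspace_fin_dim(2)[OF _ L.imT_is_subspace]
      V.func_space_finite_dim[OF finite_subset[OF J finite_I]] by simp
  then show ?thesis
    using L.rank_nullity[OF V.subspace_fin_dim(1)[OF finite_dim U]] ker by simp
qed

lemma dim_le_card:
  assumes U: "VectorSpace.subspace K U V" and J: "J \<subseteq> I"
    and inj: "\<And>x. x \<in> U \<Longrightarrow> (\<And>i. i \<in> J \<Longrightarrow> T x i = \<zero>\<^bsub>K\<^esub>) \<Longrightarrow> x = \<zero>\<^bsub>V\<^esub>"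
  shows "subdim U \<le> card J"
proof -
  have S: "VectorSpace.subspace K (U \<inter> coord_subspace (I - J)) V"
    by (rule V.subspace_Int[OF U coord_subspace])
  interpret Z: vectorspace K "V.vs (U \<inter> coord_subspace (I - J))" by (rule V.subspace_is_vs[OF S])
  have "U \<inter> coord_subspace (I - J) \<subseteq> {\<zero>\<^bsub>V\<^esub>}"
    using inj J by (auto simp: coord_subspace_def)
  then have "subdim (U \<inter> coord_subspace (I - J)) = 0"
    using Z.dim_eq_0_subset_zero by simp
  then show ?thesis using dim_le_card_plus_kernel[OF U J] by simp
qed

end


section \<open>Pairings whose vanishing is tested on edges\<close>

text \<open>All that the comparison of the Cheeger constants uses about the cup product: \<open>q x y\<close> vanishes
  iff for every edge the \<open>2 \<times> 2\<close> minor of the coordinates of \<open>x\<close> and \<open>y\<close> at its two ends vanishes.\<close>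

locale edge_minor_pairing =
  pairing K V W q + coordinates K V "Vert \<Gamma>" T + fin_simplicial_graph \<Gamma>
  for K :: "('l, 'm) ring_scheme" and V :: "('l, 'x, 'c) module_scheme"
    and W :: "('l, 'y, 'd) module_scheme" and q :: "'x \<Rightarrow> 'x \<Rightarrow> 'y"
    and \<Gamma> :: "'v simplicial_graph" and T :: "'x \<Rightarrow> 'v \<Rightarrow> 'l" +
  assumes q_eq_zero_iff: "x \<in> carrier V \<Longrightarrow> y \<in> carrier V \<Longrightarrow>
    q x y = \<zero>\<^bsub>W\<^esub> \<longleftrightarrow> (\<forall>v w. {v, w} \<in> Edge \<Gamma> \<longrightarrow> T x v \<otimes>\<^bsub>K\<^esub> T y w = T x w \<otimes>\<^bsub>K\<^esub> T y v)"
begin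

text \<open>Unlike the vertex boundary, this may contain vertices of \<open>A\<close>.\<close>

definition nbrs :: "'v set \<Rightarrow> 'v set" where
  "nbrs A = {w \<in> Vert \<Gamma>. \<exists>v\<in>A. {v, w} \<in> Edge \<Gamma>}"

lemma vertex_boundary_nbrs: "vertex_boundary \<Gamma> A = nbrs A - A"
  by (auto simp: vertex_boundary_def nbrs_def)

lemma edge_vertices:
  assumes "{v, w} \<in> Edge \<Gamma>"
  shows "v \<in> Vert \<Gamma>" "w \<in> Vert \<Gamma>" "v \<noteq> w"
  using Edge_subset[OF assms] Edge_card[OF assms] by auto

text \<open>A vector orthogonal to the unit vector at \<open>v\<close> vanishes at every neighbour of \<open>v\<close>, by the minor of the
  edge between them. Conversely, if \<open>f\<close> is supported on \<open>A\<close> and \<open>x\<close> vanishes on all neighbours of \<open>A\<close>,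
  then both products in each minor are zero.\<close>

lemma orth_coord_subspace:
  assumes A: "A \<subseteq> Vert \<Gamma>"
  shows "orth (coord_subspace A) = coord_subspace (Vert \<Gamma> - nbrs A)"
proof
  show "orth (coord_subspace A) \<subseteq> coord_subspace (Vert \<Gamma> - nbrs A)"
  proof
    fix x assume x: "x \<in> orth (coord_subspace A)"
    then have xV: "x \<in> carrier V" by (simp add: orth_def)
    have "T x w = \<zero>\<^bsub>K\<^esub>" if w: "w \<in> nbrs A" for w
    proof -
      obtain v where v: "v \<in> A" "{v, w} \<in> Edge \<Gamma>" using w by (auto simp: nbrs_def)
      have "(\<lambda>i. if i = v then \<one>\<^bsub>K\<^esub> else \<zero>\<^bsub>K\<^esub>) \<in> Vert \<Gamma> \<rightarrow> carrier K" by auto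
      from T_surj[OF this] obtain e where e: "e \<in> carrier V"
        "\<forall>i\<in>Vert \<Gamma>. T e i = (if i = v then \<one>\<^bsub>K\<^esub> else \<zero>\<^bsub>K\<^esub>)" by blast
      have "e \<in> coord_subspace A" using e v(1) by (auto simp: coord_subspace_def)
      then have "q e x = \<zero>\<^bsub>W\<^esub>" using x by (simp add: orth_def)
      then have "T e v \<otimes>\<^bsub>K\<^esub> T x w = T e w \<otimes>\<^bsub>K\<^esub> T x v"
        using q_eq_zero_iff[OF e(1) xV] v(2) by blast
      then show ?thesis
        using e(2) edge_vertices[OF v(2)] T_closed[OF xV] by auto
    qed
    then show "x \<in> coord_subspace (Vert \<Gamma> - nbrs A)"
      using xV by (simp add: coord_subspace_def)
  qed
  show "coord_subspace (Vert \<Gamma> - nbrs A) \<subseteq> orth (coord_subspace A)"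
  proof
    fix x assume x: "x \<in> coord_subspace (Vert \<Gamma> - nbrs A)"
    then have xV: "x \<in> carrier V" by (simp add: coord_subspace_def)
    have "q f x = \<zero>\<^bsub>W\<^esub>" if f: "f \<in> coord_subspace A" for f
    proof -
      have fV: "f \<in> carrier V" using f by (simp add: coord_subspace_def)
      have z: "T f v \<otimes>\<^bsub>K\<^esub> T x w = \<zero>\<^bsub>K\<^esub>" if e: "{v, w} \<in> Edge \<Gamma>" for v w
      proof (cases "v \<in> A")
        case True
        then have "T x w = \<zero>\<^bsub>K\<^esub>"
          using x e edge_vertices[OF e] by (auto simp: coord_subspace_def nbrs_def)
        then show ?thesis using T_closed[OF fV] edge_vertices[OF e] by simp
      next
        case False
        then have "T f v = \<zero>\<^bsub>K\<^esub>"
          using f edge_vertices[OF e] by (auto simp: coord_subspace_def)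
        then show ?thesis using T_closed[OF xV] edge_vertices[OF e] by simp
      qed
      have "T f v \<otimes>\<^bsub>K\<^esub> T x w = T f w \<otimes>\<^bsub>K\<^esub> T x v" if e: "{v, w} \<in> Edge \<Gamma>" for v w
        using z[OF e] z[of w v] e by (simp add: insert_commute)
      then show ?thesis using q_eq_zero_iff[OF fV xV] by blast
    qed
    then show "x \<in> orth (coord_subspace A)" using xV by (simp add: orth_def)
  qed
qed

text \<open>With \<open>N = nbrs A\<close> the numerator is \<open>n - |A| - (n - |N|) + |A - N| = |N| - |A \<inter> N| = |N - A|\<close>, where
  \<open>n\<close> is the number of vertices.\<close>

lemma cheeger_quotient_coord_subspace:
  assumes A: "A \<subseteq> Vert \<Gamma>"
  shows "cheeger_quotient (coord_subspace A) = real (card (vertex_boundary \<Gamma> A)) / real (card A)"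
proof -
  let ?N = "nbrs A"
  have N: "?N \<subseteq> Vert \<Gamma>" by (auto simp: nbrs_def)
  have fin: "finite A" "finite ?N" using A N finite_Vert by (auto intro: finite_subset)
  have "coord_subspace (Vert \<Gamma> - ?N) \<inter> coord_subspace A = coord_subspace (A - ?N)"
    using A by (auto simp: coord_subspace_def)
  then have "subdim (orth (coord_subspace A) \<inter> coord_subspace A) = card (A - ?N)"
    using A dim_coord_subspace[of "A - ?N"] by (simp add: orth_coord_subspace[OF A] subset_iff)
  moreover have "subdim (orth (coord_subspace A)) = card (Vert \<Gamma> - ?N)"
    using dim_coord_subspace[of "Vert \<Gamma> - ?N"] by (simp add: orth_coord_subspace[OF A])
  moreover have "real (card (Vert \<Gamma> - ?N)) = real (card (Vert \<Gamma>)) - real (card ?N)"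
    using N fin card_mono[OF finite_Vert N] by (simp add: card_Diff_subset of_nat_diff)
  moreover have "card A = card (A - ?N) + card (A \<inter> ?N)"
    using card_Int_Diff[OF fin(1), of ?N] by simp
  moreover have "card ?N = card (?N - A) + card (A \<inter> ?N)"
    using card_Int_Diff[OF fin(2), of A] by (simp add: inf_commute)
  ultimately show ?thesis
    unfolding cheeger_quotient_def vertex_boundary_nbrs
    by (simp add: dim_coord_subspace[OF A] dim_carrier)
qed

lemma orth_subspace:
  assumes F: "F \<subseteq> carrier V"
  shows "VectorSpace.subspace K (orth F) V"
proof -
  have "q f \<zero>\<^bsub>V\<^esub> = \<zero>\<^bsub>W\<^esub>" if "f \<in> carrier V" for f
    using smult_right[of "\<zero>\<^bsub>K\<^esub>" f "\<zero>\<^bsub>V\<^esub>"] closed[of f "\<zero>\<^bsub>V\<^esub>"] that by simp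
  then show ?thesis
    unfolding VectorSpace.subspace_def orth_def submodule_def
    using F by (auto simp: V.module_axioms V.vectorspace_axioms add_right smult_right subset_iff)
qed

definition supp :: "'x set \<Rightarrow> 'v set" where
  "supp U = {v \<in> Vert \<Gamma>. \<exists>x\<in>U. T x v \<noteq> \<zero>\<^bsub>K\<^esub>}"

text \<open>The core of the argument: \<open>A\<close> is any subset of the support of \<open>F\<close> that has \<open>dim F\<close> elements, of which
  exactly \<open>dim (C \<inter> F)\<close> lie in the support of \<open>C = orth F\<close>.\<close>

lemma exists_vertex_set_of_subspace:
  assumes F: "VectorSpace.subspace K F V"
  obtains A where "A \<subseteq> Vert \<Gamma>" "card A = subdim F"
    "card (vertex_boundary \<Gamma> A) + subdim F + subdim (orth F) \<le> card (Vert \<Gamma>) + subdim (orth F \<inter> F)"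
proof -
  let ?C = "orth F" and ?S = "supp F" and ?T = "supp (orth F)"
  have FV: "F \<subseteq> carrier V" using V.is_module[OF F] by (simp add: submodule_def)
  have CV: "?C \<subseteq> carrier V" by (auto simp: orth_def)
  note C = orth_subspace[OF FV]
  note CF = V.subspace_Int[OF C F]
  have ST: "?S \<subseteq> Vert \<Gamma>" "?T \<subseteq> Vert \<Gamma>" by (auto simp: supp_def)
  have tcF: "T x v \<in> carrier K" if "x \<in> F" "v \<in> Vert \<Gamma>" for x v using T_closed that FV by blast
  have tcC: "T x v \<in> carrier K" if "x \<in> ?C" "v \<in> Vert \<Gamma>" for x v using T_closed that CV by blast
  have minor: "T f v \<otimes>\<^bsub>K\<^esub> T c w = T f w \<otimes>\<^bsub>K\<^esub> T c v"
    if "f \<in> F" "c \<in> ?C" "{v, w} \<in> Edge \<Gamma>" for f c v w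
  proof -
    have "q f c = \<zero>\<^bsub>W\<^esub>" using that by (simp add: orth_def)
    then show ?thesis using q_eq_zero_iff[of f c] that FV CV by blast
  qed
  have zF: "T x v = \<zero>\<^bsub>K\<^esub>" if "x \<in> F" "v \<in> Vert \<Gamma> - ?S" for x v
    using that by (auto simp: supp_def)
  have zC: "T x v = \<zero>\<^bsub>K\<^esub>" if "x \<in> ?C" "v \<in> Vert \<Gamma> - ?T" for x v
    using that by (auto simp: supp_def)
  let ?k = "subdim F" and ?m = "subdim (?C \<inter> F)"
  have mk: "?m \<le> ?k" by (rule V.subspace_dim_mono[OF finite_dim CF F]) simp
  \<comment> \<open>a vector of \<open>C \<inter> F\<close> vanishes off \<open>S\<close> and off \<open>T\<close>\<close>
  have "?m \<le> card (?S \<inter> ?T)"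
  proof (rule dim_le_card[OF CF])
    show "?S \<inter> ?T \<subseteq> Vert \<Gamma>" using ST by blast
    fix x assume x: "x \<in> ?C \<inter> F" and z: "\<And>v. v \<in> ?S \<inter> ?T \<Longrightarrow> T x v = \<zero>\<^bsub>K\<^esub>"
    then show "x = \<zero>\<^bsub>V\<^esub>" using zF zC CV by (intro T_inj) blast+
  qed
  then obtain A1 where A1: "A1 \<subseteq> ?S \<inter> ?T" "card A1 = ?m" by (meson obtain_subset_with_card_n)
  \<comment> \<open>vectors of \<open>F\<close> supported on \<open>T\<close> are orthogonal to \<open>F\<close>: where such an \<open>x\<close> is nonzero, some \<open>c \<in> C\<close> is
    nonzero too, and \<open>x\<close> and \<open>g\<close> are both proportional to \<open>c\<close> along the edge\<close>
  have ker: "F \<inter> coord_subspace (Vert \<Gamma> - (?S - ?T)) \<subseteq> ?C \<inter> F"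
  proof
    fix x assume x: "x \<in> F \<inter> coord_subspace (Vert \<Gamma> - (?S - ?T))"
    have T: "v \<in> ?T" if "v \<in> Vert \<Gamma>" "T x v \<noteq> \<zero>\<^bsub>K\<^esub>" for v
      using x that by (auto simp: coord_subspace_def supp_def)
    have "q g x = \<zero>\<^bsub>W\<^esub>" if g: "g \<in> F" for g
    proof -
      have key: "T g v \<otimes>\<^bsub>K\<^esub> T x w = T g w \<otimes>\<^bsub>K\<^esub> T x v"
        if e: "{v, w} \<in> Edge \<Gamma>" and nz: "T x v \<noteq> \<zero>\<^bsub>K\<^esub>" for v w
      proof -
        note vw = edge_vertices[OF e]
        obtain c where c: "c \<in> ?C" "T c v \<noteq> \<zero>\<^bsub>K\<^esub>" using T[OF vw(1) nz] by (auto simp: supp_def)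
        have cl: "T g v \<in> carrier K" "T g w \<in> carrier K" "T x v \<in> carrier K" "T x w \<in> carrier K"
          "T c v \<in> carrier K" "T c w \<in> carrier K" using tcF tcC g x c vw by auto
        have "(T g v \<otimes>\<^bsub>K\<^esub> T x w) \<otimes>\<^bsub>K\<^esub> T c v = T g v \<otimes>\<^bsub>K\<^esub> (T x w \<otimes>\<^bsub>K\<^esub> T c v)"
          using cl by (simp add: V.m_assoc)
        also have "\<dots> = T g v \<otimes>\<^bsub>K\<^esub> (T x v \<otimes>\<^bsub>K\<^esub> T c w)" using minor[OF _ c(1) e] x by simp
        also have "\<dots> = T x v \<otimes>\<^bsub>K\<^esub> (T g v \<otimes>\<^bsub>K\<^esub> T c w)" using cl by (simp add: V.m_lcomm)
        also have "\<dots> = T x v \<otimes>\<^bsub>K\<^esub> (T g w \<otimes>\<^bsub>K\<^esub> T c v)" using minor[OF g c(1) e] by simp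
        also have "\<dots> = (T g w \<otimes>\<^bsub>K\<^esub> T x v) \<otimes>\<^bsub>K\<^esub> T c v" using cl by (simp add: V.m_ac)
        finally show ?thesis using cl c(2) V.m_rcancel by simp
      qed
      have "T g v \<otimes>\<^bsub>K\<^esub> T x w = T g w \<otimes>\<^bsub>K\<^esub> T x v" if e: "{v, w} \<in> Edge \<Gamma>" for v w
      proof (cases "T x v = \<zero>\<^bsub>K\<^esub> \<and> T x w = \<zero>\<^bsub>K\<^esub>")
        case True
        then show ?thesis using tcF[OF g] edge_vertices[OF e] by simp
      next
        case False
        then show ?thesis using key[OF e] key[of w v] e by (auto simp: insert_commute)
      qed
      then show ?thesis using q_eq_zero_iff[of g x] g x FV by blast
    qed
    then show "x \<in> ?C \<inter> F" using x FV by (auto simp: orth_def)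
  qed
  have S_T: "?S - ?T \<subseteq> Vert \<Gamma>" using ST by blast
  have "?k \<le> card (?S - ?T) + subdim (F \<inter> coord_subspace (Vert \<Gamma> - (?S - ?T)))"
    by (rule dim_le_card_plus_kernel[OF F S_T])
  also have "\<dots> \<le> card (?S - ?T) + ?m"
    using V.subspace_dim_mono[OF finite_dim V.subspace_Int[OF F coord_subspace] CF ker] by simp
  finally have "?k - ?m \<le> card (?S - ?T)" by simp
  then obtain A2 where A2: "A2 \<subseteq> ?S - ?T" "card A2 = ?k - ?m" by (meson obtain_subset_with_card_n)
  let ?A = "A1 \<union> A2"
  have fin: "finite X" if "X \<subseteq> Vert \<Gamma>" for X using that finite_Vert by (rule finite_subset)
  have A: "?A \<subseteq> ?S" using A1 A2 by blast
  have "A1 \<inter> A2 = {}" using A1 A2 by blast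
  then have cA: "card ?A = ?k"
    using card_Un_disjoint[of A1 A2] A1(2) A2(2) mk fin A A1(1) A2(1) ST by (metis Un_subset_iff le_add_diff_inverse subset_trans)
  let ?B = "vertex_boundary \<Gamma> ?A"
  have BV: "?B \<subseteq> Vert \<Gamma>" by (auto simp: vertex_boundary_def)
  have "subdim ?C \<le> card (?T - ?B)"
  proof (rule dim_le_card[OF C])
    show "?T - ?B \<subseteq> Vert \<Gamma>" using ST by blast
    fix c assume c: "c \<in> ?C" and z: "\<And>v. v \<in> ?T - ?B \<Longrightarrow> T c v = \<zero>\<^bsub>K\<^esub>"
    \<comment> \<open>a neighbour \<open>v \<in> A\<close> of \<open>w\<close> is not in the boundary, so \<open>c\<close> vanishes at \<open>v\<close>, and the minor with an
      \<open>f \<in> F\<close> that is nonzero at \<open>v\<close> carries this over to \<open>w\<close>\<close>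
    have zB: "T c w = \<zero>\<^bsub>K\<^esub>" if w: "w \<in> ?B" for w
    proof -
      obtain v where v: "v \<in> ?A" "{v, w} \<in> Edge \<Gamma>" using w by (auto simp: vertex_boundary_def)
      note vw = edge_vertices[OF v(2)]
      have "v \<notin> ?B" using v(1) by (auto simp: vertex_boundary_def)
      then have cv: "T c v = \<zero>\<^bsub>K\<^esub>" using z zC[OF c] vw by blast
      obtain f where f: "f \<in> F" "T f v \<noteq> \<zero>\<^bsub>K\<^esub>" using v(1) A by (auto simp: supp_def)
      have "T f v \<otimes>\<^bsub>K\<^esub> T c w = \<zero>\<^bsub>K\<^esub>"
        using minor[OF f(1) c v(2)] cv tcF[OF f(1) vw(2)] by simp
      then show ?thesis using f V.integral tcF[OF f(1) vw(1)] tcC[OF c vw(2)] by blast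
    qed
    show "c = \<zero>\<^bsub>V\<^esub>"
    proof (rule T_inj)
      show "c \<in> carrier V" using c CV by blast
      show "T c v = \<zero>\<^bsub>K\<^esub>" if "v \<in> Vert \<Gamma>" for v
        using that z zB zC[OF c] by blast
    qed
  qed
  moreover have "card (?T - ?B) + card (?T \<inter> ?B) = card ?T"
    using card_Int_Diff[OF fin[OF ST(2)], of ?B] by simp
  moreover have "card ?B = card (?T \<inter> ?B) + card (?B - ?T)"
    using card_Int_Diff[OF fin[OF BV], of ?T] by (simp add: inf_commute)
  \<comment> \<open>these three sets are disjoint: \<open>A2\<close> avoids \<open>T\<close> by choice, and the boundary avoids \<open>A2\<close>\<close>
  moreover have "card (?B - ?T) + card A2 + card ?T \<le> card (Vert \<Gamma>)"
  proof -
    have "card ((?B - ?T) \<union> A2 \<union> ?T) = card (?B - ?T) + card A2 + card ?T"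
      using A2 fin[OF ST(2)] fin[OF BV] fin[of A2] ST
      by (subst card_Un_disjoint; auto simp: vertex_boundary_def)+
    moreover have "(?B - ?T) \<union> A2 \<union> ?T \<subseteq> Vert \<Gamma>" using BV A2 ST by blast
    ultimately show ?thesis using card_mono[OF finite_Vert] by metis
  qed
  ultimately have "card ?B + ?k + subdim ?C \<le> card (Vert \<Gamma>) + ?m"
    using A2(2) mk by linarith
  with cA A ST show ?thesis by (intro that[of ?A]) auto
qed

theorem cheeger_eq_graph_cheeger: "cheeger = graph_cheeger \<Gamma>"
proof (rule antisym)
  show "cheeger \<le> graph_cheeger \<Gamma>"
    unfolding graph_cheeger_def
  proof (rule INF_greatest)
    fix A assume "A \<in> {A. A \<subseteq> Vert \<Gamma> \<and> A \<noteq> {} \<and> real (card A) \<le> real (card (Vert \<Gamma>)) / 2}"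
    then have A: "A \<subseteq> Vert \<Gamma>" "A \<noteq> {}" "real (card A) \<le> real (card (Vert \<Gamma>)) / 2" by auto
    have "0 < card A" using A finite_subset[OF A(1) finite_Vert] by (simp add: card_gt_0_iff)
    then show "cheeger \<le> ereal (real (card (vertex_boundary \<Gamma> A)) / real (card A))"
      unfolding cheeger_def cheeger_quotient_coord_subspace[OF A(1), symmetric]
      using A coord_subspace by (intro INF_lower) (auto simp: dim_coord_subspace dim_carrier)
  qed
  show "graph_cheeger \<Gamma> \<le> cheeger"
    unfolding cheeger_def
  proof (rule INF_greatest)
    fix F assume "F \<in> {F. VectorSpace.subspace K F V \<and> 0 < real (subdim F)
      \<and> real (subdim F) \<le> real (subdim (carrier V)) / 2}"
    then have F: "VectorSpace.subspace K F V" "0 < subdim F"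
      "real (subdim F) \<le> real (card (Vert \<Gamma>)) / 2" by (auto simp: dim_carrier)
    obtain A where A: "A \<subseteq> Vert \<Gamma>" "card A = subdim F"
      "card (vertex_boundary \<Gamma> A) + subdim F + subdim (orth F) \<le> card (Vert \<Gamma>) + subdim (orth F \<inter> F)"
      using exists_vertex_set_of_subspace[OF F(1)] .
    have "graph_cheeger \<Gamma> \<le> ereal (real (card (vertex_boundary \<Gamma> A)) / real (card A))"
      unfolding graph_cheeger_def using A F by (intro INF_lower) auto
    also have "\<dots> \<le> ereal (cheeger_quotient F)"
      unfolding cheeger_quotient_def dim_carrier A(2) ereal_less_eq using A(3) F(2)
      by (intro divide_right_mono) linarith+
    finally show "graph_cheeger \<Gamma> \<le> ereal (cheeger_quotient F)" .
  qed
qed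

end

section \<open>Homomorphisms out of a presented group\<close>

lemma words_simps [simp]:
  "[] \<in> words S"
  "l # w \<in> words S \<longleftrightarrow> fst l \<in> S \<and> w \<in> words S"
  "u @ v \<in> words S \<longleftrightarrow> u \<in> words S \<and> v \<in> words S"
  by (auto simp: words_def mem_Times_iff)

definition letter_eval :: "('h, 'n) monoid_scheme \<Rightarrow> ('s \<Rightarrow> 'h) \<Rightarrow> 's \<times> bool \<Rightarrow> 'h" where
  "letter_eval H \<phi> l = (if snd l then \<phi> (fst l) else inv\<^bsub>H\<^esub> \<phi> (fst l))"

definition word_eval :: "('h, 'n) monoid_scheme \<Rightarrow> ('s \<Rightarrow> 'h) \<Rightarrow> 's word \<Rightarrow> 'h" where
  "word_eval H \<phi> w = foldr (\<lambda>l x. letter_eval H \<phi> l \<otimes>\<^bsub>H\<^esub> x) w \<one>\<^bsub>H\<^esub>"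

lemma word_eval_simps [simp]:
  "word_eval H \<phi> [] = \<one>\<^bsub>H\<^esub>"
  "word_eval H \<phi> (l # w) = letter_eval H \<phi> l \<otimes>\<^bsub>H\<^esub> word_eval H \<phi> w"
  by (simp_all add: word_eval_def)

context group
begin

context
  fixes \<phi> :: "'s \<Rightarrow> 'a" and S :: "'s set"
  assumes \<phi>: "\<phi> \<in> S \<rightarrow> carrier G"
begin

lemma letter_eval_closed [simp]: "fst l \<in> S \<Longrightarrow> letter_eval G \<phi> l \<in> carrier G"
  using \<phi> by (auto simp: letter_eval_def Pi_iff)

lemma word_eval_closed [simp]: "w \<in> words S \<Longrightarrow> word_eval G \<phi> w \<in> carrier G"
  by (induct w) auto

lemma word_eval_append:
  "u \<in> words S \<Longrightarrow> v \<in> words S \<Longrightarrow> word_eval G \<phi> (u @ v) = word_eval G \<phi> u \<otimes> word_eval G \<phi> v"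
  by (induct u) (auto simp: m_assoc)

lemma letter_eval_cancel:
  "s \<in> S \<Longrightarrow> letter_eval G \<phi> (s, b) \<otimes> letter_eval G \<phi> (s, \<not> b) = \<one>"
  using \<phi> by (auto simp: letter_eval_def Pi_iff)

lemma word_eval_cong:
  assumes "(u, v) \<in> presentation_cong S R" and R: "R \<subseteq> words S" "\<And>r. r \<in> R \<Longrightarrow> word_eval G \<phi> r = \<one>"
  shows "word_eval G \<phi> u = word_eval G \<phi> v"
  using assms(1)
proof induct
  case (cancel u v s b)
  have "word_eval G \<phi> [(s, b), (s, \<not> b)] = \<one>"
    using cancel(3) by (simp add: letter_eval_cancel)
  then have "word_eval G \<phi> ([(s, b), (s, \<not> b)] @ v) = word_eval G \<phi> v"
    using cancel by (subst word_eval_append) auto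
  then show ?case
    using cancel by (subst (1 2) word_eval_append) auto
next
  case (relator u v r)
  then have "r \<in> words S" using R by blast
  then show ?case
    using relator by (simp add: word_eval_append R(2))
qed auto

end

end

definition word_inverse :: "'s word \<Rightarrow> 's word" where
  "word_inverse w = rev (map (\<lambda>l. (fst l, \<not> snd l)) w)"

locale presentation =
  fixes S :: "'s set" and R :: "'s word set"
  assumes relators: "R \<subseteq> words S"
begin

abbreviation P :: "'s word set monoid" where
  "P \<equiv> presented_group S R"

definition word_class :: "'s word \<Rightarrow> 's word set" where
  "word_class w = presentation_cong S R `` {w}"

abbreviation gen :: "'s \<Rightarrow> 's word set" where
  "gen s \<equiv> word_class [(s, True)]"

lemma cong_words:
  assumes "(u, v) \<in> presentation_cong S R"
  shows "u \<in> words S" "v \<in> words S"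
  using assms by (induct) (use relators in auto)

lemma equiv_cong: "equiv (words S) (presentation_cong S R)"
proof (rule equivI)
  show "presentation_cong S R \<subseteq> words S \<times> words S" using cong_words by auto
  show "refl_on (words S) (presentation_cong S R)"
    using presentation_cong.refl by (auto simp: refl_on_def)
  show "sym (presentation_cong S R)" by (auto intro!: symI presentation_cong.sym)
  show "trans (presentation_cong S R)" by (auto intro!: transI intro: presentation_cong.trans)
qed

lemma cong_append_left:
  assumes "(u, v) \<in> presentation_cong S R" and w: "w \<in> words S"
  shows "(w @ u, w @ v) \<in> presentation_cong S R"
  using assms(1)
proof induct
  case (refl u)
  then show ?case using w by (auto intro: presentation_cong.refl)
next
  case (cancel u v s b)
  then show ?case using presentation_cong.cancel[of "w @ u" S v s b R] w by simp
next
  case (relator u v r)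
  then show ?case using presentation_cong.relator[of "w @ u" S v r R] w by simp
qed (blast intro: presentation_cong.sym presentation_cong.trans)+

lemma cong_append_right:
  assumes "(u, v) \<in> presentation_cong S R" and w: "w \<in> words S"
  shows "(u @ w, v @ w) \<in> presentation_cong S R"
  using assms(1)
proof induct
  case (refl u)
  then show ?case using w by (auto intro: presentation_cong.refl)
next
  case (cancel u v s b)
  then show ?case using presentation_cong.cancel[of u S "v @ w" s b R] w by simp
next
  case (relator u v r)
  then show ?case using presentation_cong.relator[of u S "v @ w" r R] w by simp
qed (blast intro: presentation_cong.sym presentation_cong.trans)+

lemma word_class_eq_iff:
  "u \<in> words S \<Longrightarrow> v \<in> words S \<Longrightarrow> word_class u = word_class v \<longleftrightarrow> (u, v) \<in> presentation_cong S R"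
  unfolding word_class_def using eq_equiv_class_iff[OF equiv_cong] .

lemma carrier_P: "carrier P = word_class ` words S"
  by (auto simp: presented_group_def quotient_def word_class_def)

lemma word_class_closed [simp]: "w \<in> words S \<Longrightarrow> word_class w \<in> carrier P"
  by (simp add: carrier_P)

lemma one_P: "\<one>\<^bsub>P\<^esub> = word_class []"
  by (simp add: presented_group_def word_class_def)

lemma mult_P:
  assumes u: "u \<in> words S" and v: "v \<in> words S"
  shows "word_class u \<otimes>\<^bsub>P\<^esub> word_class v = word_class (u @ v)"
proof -
  have eq: "word_class (u' @ v') = word_class (u @ v)"
    if "(u, u') \<in> presentation_cong S R" "(v, v') \<in> presentation_cong S R" for u' v'
  proof -
    have "(u @ v, u' @ v') \<in> presentation_cong S R"
      using cong_append_left[OF that(2) u] cong_append_right[OF that(1) cong_words(2)[OF that(2)]]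
      by (rule presentation_cong.trans)
    then show ?thesis using word_class_eq_iff cong_words by metis
  qed
  have "u \<in> word_class u" "v \<in> word_class v"
    using u v by (auto simp: word_class_def intro: presentation_cong.refl)
  moreover have "word_class u \<otimes>\<^bsub>P\<^esub> word_class v = (\<Union>u'\<in>word_class u. \<Union>v'\<in>word_class v. word_class (u' @ v'))"
    by (simp add: presented_group_def word_class_def)
  moreover have "\<dots> = (\<Union>u'\<in>word_class u. \<Union>v'\<in>word_class v. word_class (u @ v))"
    by (intro SUP_cong refl eq) (auto simp: word_class_def)
  ultimately show ?thesis by auto
qed

lemma word_inverse_words: "w \<in> words S \<Longrightarrow> word_inverse w \<in> words S"
  by (induct w) (auto simp: word_inverse_def)

lemma word_inverse_cong:
  "w \<in> words S \<Longrightarrow> (word_inverse w @ w, []) \<in> presentation_cong S R"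
proof (induct w)
  case Nil
  then show ?case by (simp add: word_inverse_def presentation_cong.refl)
next
  case (Cons l w)
  then have w: "w \<in> words S" "fst l \<in> S" by auto
  have "(word_inverse w @ [(fst l, \<not> snd l), (fst l, \<not> \<not> snd l)] @ w, word_inverse w @ w)
      \<in> presentation_cong S R"
    using w word_inverse_words by (intro presentation_cong.cancel) auto
  then show ?case
    using Cons(1)[OF w(1)] by (auto simp: word_inverse_def intro: presentation_cong.trans)
qed

lemma group_P: "group P"
proof (rule groupI)
  show "\<one>\<^bsub>P\<^esub> \<in> carrier P" by (simp add: one_P)
  fix x assume "x \<in> carrier P"
  then obtain u where u: "u \<in> words S" "x = word_class u" by (auto simp: carrier_P)
  show "\<one>\<^bsub>P\<^esub> \<otimes>\<^bsub>P\<^esub> x = x" using u by (simp add: one_P mult_P)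
  show "\<exists>y\<in>carrier P. y \<otimes>\<^bsub>P\<^esub> x = \<one>\<^bsub>P\<^esub>"
  proof
    show "word_class (word_inverse u) \<in> carrier P" using u word_inverse_words by simp
    show "word_class (word_inverse u) \<otimes>\<^bsub>P\<^esub> x = \<one>\<^bsub>P\<^esub>"
      using u word_inverse_words word_inverse_cong by (simp add: one_P mult_P word_class_eq_iff)
  qed
  fix y assume "y \<in> carrier P"
  then obtain v where v: "v \<in> words S" "y = word_class v" by (auto simp: carrier_P)
  show "x \<otimes>\<^bsub>P\<^esub> y \<in> carrier P" using u v by (simp add: mult_P)
  fix z assume "z \<in> carrier P"
  then obtain w where w: "w \<in> words S" "z = word_class w" by (auto simp: carrier_P)
  show "x \<otimes>\<^bsub>P\<^esub> y \<otimes>\<^bsub>P\<^esub> z = x \<otimes>\<^bsub>P\<^esub> (y \<otimes>\<^bsub>P\<^esub> z)" using u v w by (simp add: mult_P)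
qed

text \<open>The universal property of a presentation: an assignment of the generators that kills the relators
  extends to a homomorphism.\<close>

lemma exists_hom:
  assumes H: "group H" and \<phi>: "\<phi> \<in> S \<rightarrow> carrier H"
    and rel: "\<And>r. r \<in> R \<Longrightarrow> word_eval H \<phi> r = \<one>\<^bsub>H\<^esub>"
  obtains h where "h \<in> hom P H" "\<And>s. s \<in> S \<Longrightarrow> h (gen s) = \<phi> s"
proof
  interpret H: group H by (rule H)
  let ?h = "\<lambda>X. word_eval H \<phi> (SOME w. w \<in> X)"
  have h: "?h (word_class w) = word_eval H \<phi> w" if "w \<in> words S" for w
  proof -
    have "w \<in> word_class w" using that by (auto simp: word_class_def intro: presentation_cong.refl)
    then have "(SOME w'. w' \<in> word_class w) \<in> word_class w" by (rule someI)
    then have "(w, SOME w'. w' \<in> word_class w) \<in> presentation_cong S R" by (simp add: word_class_def)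
    from H.word_eval_cong[OF \<phi> this relators rel] show ?thesis by simp
  qed
  show "?h \<in> hom P H"
    using H.word_eval_append[OF \<phi>] H.word_eval_closed[OF \<phi>]
    by (auto simp: hom_def carrier_P h mult_P)
  show "?h (gen s) = \<phi> s" if "s \<in> S" for s
    using that \<phi> by (auto simp: h letter_eval_def Pi_iff)
qed

lemma hom_word_class:
  assumes H: "group H" and h: "h \<in> hom P H" and w: "w \<in> words S"
  shows "h (word_class w) = word_eval H (\<lambda>s. h (gen s)) w"
  using w
proof (induct w)
  case Nil
  then show ?case using hom_one[OF h group_P H] by (simp add: one_P)
next
  case (Cons l w)
  then have l: "fst l \<in> S" and w: "w \<in> words S" by auto
  interpret h: group_hom P H h
    using group_P H h by (simp add: group_hom_def group_hom_axioms_def)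
  have "h (word_class [l]) = letter_eval H (\<lambda>s. h (gen s)) l"
  proof (cases "snd l")
    case True
    then have "l = (fst l, True)" by (metis prod.collapse)
    then show ?thesis using True by (metis letter_eval_def)
  next
    case False
    then have l': "l = (fst l, False)" by (metis prod.collapse)
    have "word_class [l] \<otimes>\<^bsub>P\<^esub> gen (fst l) = \<one>\<^bsub>P\<^esub>"
      using l l' presentation_cong.cancel[of "[]" S "[]" "fst l" False R]
      by (simp add: mult_P one_P word_class_eq_iff)
    then have "word_class [l] = inv\<^bsub>P\<^esub> (gen (fst l))"
      using l by (intro group.inv_equality[OF group_P, symmetric]) auto
    then show ?thesis using l False by (simp add: letter_eval_def)
  qed
  moreover have "word_class (l # w) = word_class [l] \<otimes>\<^bsub>P\<^esub> word_class w"
    using l w by (simp add: mult_P)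
  ultimately show ?case using Cons l w by simp
qed

lemma hom_eqI:
  assumes H: "group H" and h: "h \<in> hom P H" and h': "h' \<in> hom P H"
    and eq: "\<And>s. s \<in> S \<Longrightarrow> h (gen s) = h' (gen s)" and x: "x \<in> carrier P"
  shows "h x = h' x"
proof -
  obtain w where w: "w \<in> words S" "x = word_class w" using x by (auto simp: carrier_P)
  have "word_eval H (\<lambda>s. h (gen s)) w = word_eval H (\<lambda>s. h' (gen s)) w"
    using w(1) by (induct w) (auto simp: letter_eval_def eq)
  then show ?thesis using hom_word_class[OF H h w(1)] hom_word_class[OF H h' w(1)] w(2) by simp
qed

end

context group
begin

lemma word_eval_commutator_word:
  assumes "\<phi> v \<in> carrier G" "\<phi> w \<in> carrier G" "\<phi> v \<otimes> \<phi> w = \<phi> w \<otimes> \<phi> v"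
  shows "word_eval G \<phi> (commutator_word v w) = \<one>"
proof -
  have "word_eval G \<phi> (commutator_word v w) = (\<phi> v \<otimes> \<phi> w) \<otimes> (inv (\<phi> v) \<otimes> inv (\<phi> w))"
    using assms(1,2) by (simp add: commutator_word_def letter_eval_def m_assoc)
  also have "inv (\<phi> v) \<otimes> inv (\<phi> w) = inv (\<phi> v \<otimes> \<phi> w)"
    using assms by (simp add: inv_mult_group)
  finally show ?thesis using assms(1,2) by simp
qed

end

section \<open>Quotient modules\<close>

context Module.module
begin

lemma submodule_abelian_subgroup:
  assumes N: "submodule R N M"
  shows "abelian_subgroup N M"
proof (rule abelian_subgroupI3)
  interpret N: submodule R N M by (rule N)
  have "\<ominus>\<^bsub>M\<^esub> x \<in> N" if x: "x \<in> N" for x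
  proof -
    have "(\<ominus> \<one>) \<odot>\<^bsub>M\<^esub> x = \<ominus>\<^bsub>M\<^esub> x" using x N.subset by (intro smult_minus_1) blast
    then show ?thesis using N.smult_closed[of "\<ominus> \<one>" x] x by simp
  qed
  then have "subgroup N (add_monoid M)"
    using N.subset N.m_closed N.zero_closed by (unfold_locales) (auto simp: a_inv_def)
  then show "additive_subgroup N M" by (rule additive_subgroupI)
qed (rule M.abelian_group_axioms)

context
  fixes N :: "'c set"
  assumes N: "submodule R N M"
begin

interpretation N: submodule R N M by (rule N)
interpretation A: abelian_subgroup N M by (rule submodule_abelian_subgroup[OF N])

lemma quotient_carrier: "carrier (quotient_module M N) = (\<lambda>x. N +>\<^bsub>M\<^esub> x) ` carrier M"
  by (auto simp: quotient_module_def A_RCOSETS_def')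

lemma quotient_zero: "\<zero>\<^bsub>quotient_module M N\<^esub> = N"
  by (simp add: quotient_module_def)

lemma coset_eq_submodule_iff: "x \<in> carrier M \<Longrightarrow> N +>\<^bsub>M\<^esub> x = N \<longleftrightarrow> x \<in> N"
  using M.a_coset_join1[OF _ _ A.a_subgroup] M.a_coset_join2[OF _ A.a_subgroup] by blast

lemma quotient_add:
  "x \<in> carrier M \<Longrightarrow> y \<in> carrier M \<Longrightarrow>
    (N +>\<^bsub>M\<^esub> x) \<oplus>\<^bsub>quotient_module M N\<^esub> (N +>\<^bsub>M\<^esub> y) = N +>\<^bsub>M\<^esub> (x \<oplus>\<^bsub>M\<^esub> y)"
  by (simp add: quotient_module_def A.a_rcos_sum)

text \<open>The scalar multiple of a coset is defined as a union over all representatives; these give the same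
  coset because \<open>N\<close> is closed under scalar multiplication.\<close>

lemma quotient_smult:
  assumes c: "c \<in> carrier R" and x: "x \<in> carrier M"
  shows "c \<odot>\<^bsub>quotient_module M N\<^esub> (N +>\<^bsub>M\<^esub> x) = N +>\<^bsub>M\<^esub> (c \<odot>\<^bsub>M\<^esub> x)"
proof -
  have eq: "N +>\<^bsub>M\<^esub> (c \<odot>\<^bsub>M\<^esub> y) = N +>\<^bsub>M\<^esub> (c \<odot>\<^bsub>M\<^esub> x)" if y: "y \<in> N +>\<^bsub>M\<^esub> x" for y
  proof -
    obtain n where n: "n \<in> N" "y = n \<oplus>\<^bsub>M\<^esub> x" using y by (auto simp: a_r_coset_def')
    then have "n \<in> carrier M" using N.subset by blast
    then have "c \<odot>\<^bsub>M\<^esub> y = c \<odot>\<^bsub>M\<^esub> n \<oplus>\<^bsub>M\<^esub> c \<odot>\<^bsub>M\<^esub> x" using n c x by (simp add: smult_r_distr)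
    moreover have "c \<odot>\<^bsub>M\<^esub> n \<oplus>\<^bsub>M\<^esub> c \<odot>\<^bsub>M\<^esub> x \<in> N +>\<^bsub>M\<^esub> (c \<odot>\<^bsub>M\<^esub> x)"
      using n c by (auto simp: a_r_coset_def')
    ultimately show ?thesis
      using M.a_repr_independence[OF _ _ A.a_subgroup] c x by (metis smult_closed)
  qed
  have "(\<Union>y\<in>N +>\<^bsub>M\<^esub> x. N +>\<^bsub>M\<^esub> (c \<odot>\<^bsub>M\<^esub> y)) = (\<Union>y\<in>N +>\<^bsub>M\<^esub> x. N +>\<^bsub>M\<^esub> (c \<odot>\<^bsub>M\<^esub> x))"
    by (intro SUP_cong HOL.refl eq)
  also have "\<dots> = N +>\<^bsub>M\<^esub> (c \<odot>\<^bsub>M\<^esub> x)" using A.a_rcos_self[OF x] by blast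
  finally show ?thesis by (simp add: quotient_module_def)
qed

lemma quotient_is_module: "Module.module R (quotient_module M N)"
proof -
  have z: "\<zero>\<^bsub>quotient_module M N\<^esub> = N +>\<^bsub>M\<^esub> \<zero>\<^bsub>M\<^esub>"
    using N.subset by (simp add: quotient_zero)
  show ?thesis
  proof (rule module_criteria)
  show "cring R" by (rule R.cring_axioms)
  show "\<zero>\<^bsub>quotient_module M N\<^esub> \<in> carrier (quotient_module M N)"
    by (simp add: z quotient_carrier)
  show "\<forall>v\<in>carrier (quotient_module M N). \<exists>w\<in>carrier (quotient_module M N).
      v \<oplus>\<^bsub>quotient_module M N\<^esub> w = \<zero>\<^bsub>quotient_module M N\<^esub>"
    using quotient_add[of _ "\<ominus>\<^bsub>M\<^esub> _"] by (auto simp: z quotient_carrier M.r_neg intro!: bexI[of _ "\<ominus>\<^bsub>M\<^esub> _"])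
qed (auto simp: z quotient_carrier quotient_add quotient_smult M.a_ac smult_assoc1
    smult_l_distr smult_r_distr)
qed

end

end

lemma (in vectorspace) quotient_is_vectorspace:
  "submodule K N V \<Longrightarrow> vectorspace K (quotient_module V N)"
  using quotient_is_module field_axioms by (auto simp: vectorspace_def)

section \<open>The bar complex and the cup product in degree one\<close>

lemma tuples_0: "tuples G 0 = {[]}"
  by (auto simp: tuples_def)

lemma tuples_Suc: "tuples G (Suc n) = (\<Union>g\<in>carrier G. (#) g ` tuples G n)"
  by (force simp: tuples_def length_Suc_conv)

lemma Cons_in_tuples: "g # xs \<in> tuples G (Suc n) \<longleftrightarrow> g \<in> carrier G \<and> xs \<in> tuples G n"
  by (auto simp: tuples_Suc)

lemmas Cons_in_tuples_simps = tuples_0 Cons_in_tuples numeral_2_eq_2 numeral_3_eq_3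

lemmas tuples_simps = tuples_0 tuples_Suc numeral_2_eq_2 numeral_3_eq_3

text \<open>The coboundary is shown to be linear in every degree; that it squares to zero is verified on \<open>0\<close>- and
  \<open>1\<close>-cochains, which makes \<open>B 1\<close> and \<open>B 2\<close> submodules of the cocycles and so \<open>H\<^sup>1\<close> and \<open>H\<^sup>2\<close> vector
  spaces.\<close>

locale bar_complex = L: field L + G: group G
  for L :: "('l, 'm) ring_scheme" and G :: "('g, 'n) monoid_scheme"
begin

abbreviation C :: "nat \<Rightarrow> ('l, 'g list \<Rightarrow> 'l) module" where "C n \<equiv> cochains L G n"
abbreviation Z :: "nat \<Rightarrow> ('l, 'g list \<Rightarrow> 'l) module" where "Z n \<equiv> cocycles L G n"
abbreviation B :: "nat \<Rightarrow> ('g list \<Rightarrow> 'l) set" where "B n \<equiv> coboundaries L G n"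
abbreviation d :: "nat \<Rightarrow> ('g list \<Rightarrow> 'l) \<Rightarrow> ('g list \<Rightarrow> 'l)" where "d n \<equiv> coboundary L G n"

lemma cochains_vectorspace: "vectorspace L (C n)"
  unfolding cochains_def by (rule L.func_space_vectorspace)

lemmas cochains_simps = L.func_space_simps[of "tuples G n" for n, folded cochains_def]

lemma cochain_closed: "f \<in> carrier (C n) \<Longrightarrow> xs \<in> tuples G n \<Longrightarrow> f xs \<in> carrier L"
  by (auto simp: cochains_simps)

lemma cochain_eqI:
  "f \<in> carrier (C n) \<Longrightarrow> g \<in> carrier (C n) \<Longrightarrow> (\<And>xs. xs \<in> tuples G n \<Longrightarrow> f xs = g xs) \<Longrightarrow> f = g"
  unfolding cochains_simps by (rule PiE_ext)

lemma tl_tuples: "xs \<in> tuples G (Suc n) \<Longrightarrow> tl xs \<in> tuples G n"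
  by (auto simp: tuples_Suc)

lemma butlast_tuples: "xs \<in> tuples G (Suc n) \<Longrightarrow> butlast xs \<in> tuples G n"
  by (auto simp: tuples_def dest: in_set_butlastD)

lemma merge_at_tuples:
  assumes xs: "xs \<in> tuples G (Suc n)" and i: "i < n"
  shows "merge_at G i xs \<in> tuples G n"
proof -
  have "xs ! i \<in> carrier G" "xs ! Suc i \<in> carrier G"
    using xs i by (auto simp: tuples_def subset_iff)
  then show ?thesis
    using xs i by (auto simp: merge_at_def tuples_def dest: in_set_takeD in_set_dropD)
qed

lemma sign_closed: "(\<ominus>\<^bsub>L\<^esub> \<one>\<^bsub>L\<^esub>) [^]\<^bsub>L\<^esub> (k::nat) \<in> carrier L"
  by simp

lemma coboundary_linear: "linear_map L (C n) (C (Suc n)) (d n)"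
proof -
  have cl: "f (tl xs) \<in> carrier L" "f (butlast xs) \<in> carrier L"
    "\<And>i. i < n \<Longrightarrow> f (merge_at G i xs) \<in> carrier L"
    if "f \<in> carrier (C n)" "xs \<in> tuples G (Suc n)" for f xs
    using that cochain_closed tl_tuples butlast_tuples merge_at_tuples by blast+
  let ?s = "\<lambda>f xs. \<lambda>i. (\<ominus>\<^bsub>L\<^esub> \<one>\<^bsub>L\<^esub>) [^]\<^bsub>L\<^esub> Suc i \<otimes>\<^bsub>L\<^esub> f (merge_at G i xs)"
  have s: "?s f xs \<in> {..<n} \<rightarrow> carrier L" if "f \<in> carrier (C n)" "xs \<in> tuples G (Suc n)" for f xs
    using cl(3)[OF that] sign_closed by blast
  have fs: "finsum L (?s f xs) {..<n} \<in> carrier L" if "f \<in> carrier (C n)" "xs \<in> tuples G (Suc n)" for f xs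
    using L.finsum_closed[OF s[OF that]] .
  have dcl: "d n f \<in> carrier (C (Suc n))" if "f \<in> carrier (C n)" for f
    unfolding coboundary_def cochains_simps
    using cl[OF that] fs[OF that] sign_closed by (intro restrict_PiE_iff[THEN iffD2] ballI L.a_closed L.m_closed) blast+
  have add: "d n (f \<oplus>\<^bsub>C n\<^esub> g) = d n f \<oplus>\<^bsub>C (Suc n)\<^esub> d n g"
    if f: "f \<in> carrier (C n)" and g: "g \<in> carrier (C n)" for f g
    unfolding coboundary_def cochains_simps
  proof (intro restrict_ext)
    fix xs assume xs: "xs \<in> tuples G (Suc n)"
    have "finsum L (?s (\<lambda>v\<in>tuples G n. f v \<oplus>\<^bsub>L\<^esub> g v) xs) {..<n}
        = finsum L (\<lambda>i. ?s f xs i \<oplus>\<^bsub>L\<^esub> ?s g xs i) {..<n}"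
      using s[OF f xs] s[OF g xs] cl[OF f xs] cl[OF g xs] xs sign_closed merge_at_tuples
      by (intro L.finsum_cong') (auto simp: L.r_distr simp del: L.nat_pow_Suc)
    also have "\<dots> = finsum L (?s f xs) {..<n} \<oplus>\<^bsub>L\<^esub> finsum L (?s g xs) {..<n}"
      by (rule L.finsum_addf[OF s[OF f xs] s[OF g xs]])
    finally show "(\<lambda>v\<in>tuples G n. f v \<oplus>\<^bsub>L\<^esub> g v) (tl xs)
        \<oplus>\<^bsub>L\<^esub> finsum L (?s (\<lambda>v\<in>tuples G n. f v \<oplus>\<^bsub>L\<^esub> g v) xs) {..<n}
        \<oplus>\<^bsub>L\<^esub> (\<ominus>\<^bsub>L\<^esub> \<one>\<^bsub>L\<^esub>) [^]\<^bsub>L\<^esub> Suc n \<otimes>\<^bsub>L\<^esub> (\<lambda>v\<in>tuples G n. f v \<oplus>\<^bsub>L\<^esub> g v) (butlast xs)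
      = (\<lambda>xs\<in>tuples G (Suc n). f (tl xs) \<oplus>\<^bsub>L\<^esub> finsum L (?s f xs) {..<n}
          \<oplus>\<^bsub>L\<^esub> (\<ominus>\<^bsub>L\<^esub> \<one>\<^bsub>L\<^esub>) [^]\<^bsub>L\<^esub> Suc n \<otimes>\<^bsub>L\<^esub> f (butlast xs)) xs
        \<oplus>\<^bsub>L\<^esub> (\<lambda>xs\<in>tuples G (Suc n). g (tl xs) \<oplus>\<^bsub>L\<^esub> finsum L (?s g xs) {..<n}
          \<oplus>\<^bsub>L\<^esub> (\<ominus>\<^bsub>L\<^esub> \<one>\<^bsub>L\<^esub>) [^]\<^bsub>L\<^esub> Suc n \<otimes>\<^bsub>L\<^esub> g (butlast xs)) xs"
      using xs tl_tuples[OF xs] butlast_tuples[OF xs] cl[OF f xs] cl[OF g xs] fs[OF f xs] fs[OF g xs]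
        sign_closed[of "Suc n"]
      by (simp add: L.r_distr L.a_ac del: L.nat_pow_Suc)
  qed
  have smult: "d n (c \<odot>\<^bsub>C n\<^esub> f) = c \<odot>\<^bsub>C (Suc n)\<^esub> d n f"
    if c: "c \<in> carrier L" and f: "f \<in> carrier (C n)" for c f
    unfolding coboundary_def cochains_simps
  proof (intro restrict_ext)
    fix xs assume xs: "xs \<in> tuples G (Suc n)"
    have "finsum L (?s (\<lambda>v\<in>tuples G n. c \<otimes>\<^bsub>L\<^esub> f v) xs) {..<n}
        = finsum L (\<lambda>i. c \<otimes>\<^bsub>L\<^esub> ?s f xs i) {..<n}"
      using s[OF f xs] cl[OF f xs] xs sign_closed merge_at_tuples c
      by (intro L.finsum_cong') (auto simp: L.m_lcomm simp del: L.nat_pow_Suc)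
    also have "\<dots> = c \<otimes>\<^bsub>L\<^esub> finsum L (?s f xs) {..<n}"
      using L.finsum_rdistr[OF _ c s[OF f xs]] by simp
    finally show "(\<lambda>v\<in>tuples G n. c \<otimes>\<^bsub>L\<^esub> f v) (tl xs)
        \<oplus>\<^bsub>L\<^esub> finsum L (?s (\<lambda>v\<in>tuples G n. c \<otimes>\<^bsub>L\<^esub> f v) xs) {..<n}
        \<oplus>\<^bsub>L\<^esub> (\<ominus>\<^bsub>L\<^esub> \<one>\<^bsub>L\<^esub>) [^]\<^bsub>L\<^esub> Suc n \<otimes>\<^bsub>L\<^esub> (\<lambda>v\<in>tuples G n. c \<otimes>\<^bsub>L\<^esub> f v) (butlast xs)
      = c \<otimes>\<^bsub>L\<^esub> (\<lambda>xs\<in>tuples G (Suc n). f (tl xs) \<oplus>\<^bsub>L\<^esub> finsum L (?s f xs) {..<n}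
          \<oplus>\<^bsub>L\<^esub> (\<ominus>\<^bsub>L\<^esub> \<one>\<^bsub>L\<^esub>) [^]\<^bsub>L\<^esub> Suc n \<otimes>\<^bsub>L\<^esub> f (butlast xs)) xs"
      using xs tl_tuples[OF xs] butlast_tuples[OF xs] cl[OF f xs] fs[OF f xs] c
        sign_closed[of "Suc n"]
      by (simp add: L.r_distr L.m_lcomm del: L.nat_pow_Suc)
  qed
  have "mod_hom L (C n) (C (Suc n)) (d n)"
    using cochains_vectorspace[of n] cochains_vectorspace[of "Suc n"] dcl add smult
    unfolding mod_hom_def mod_hom_axioms_def LinearCombinations.module_hom_def vectorspace_def by auto
  then show ?thesis by (simp add: linear_map_def cochains_vectorspace)
qed

lemma cocycles_subspace: "VectorSpace.subspace L (carrier (Z n)) (C n)"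
proof -
  interpret D: linear_map L "C n" "C (Suc n)" "d n" by (rule coboundary_linear)
  show ?thesis using D.kerT_is_subspace by (simp add: cocycles_def D.ker_def)
qed

lemma cocycles_vectorspace: "vectorspace L (Z n)"
  using vectorspace.subspace_is_vs[OF cochains_vectorspace cocycles_subspace]
  by (simp add: cocycles_def)

lemma cocycles_ops [simp]:
  "add (Z n) = add (C n)" "zero (Z n) = zero (C n)" "smult (Z n) = smult (C n)"
  by (simp_all add: cocycles_def)

lemma coboundaries_submodule:
  assumes "\<And>f. f \<in> carrier (C n) \<Longrightarrow> d (Suc n) (d n f) = \<zero>\<^bsub>C (Suc (Suc n))\<^esub>"
  shows "submodule L (B (Suc n)) (Z (Suc n))"
proof -
  interpret D: linear_map L "C n" "C (Suc n)" "d n" by (rule coboundary_linear)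
  have "submodule L (B (Suc n)) (C (Suc n))"
    using D.im_is_submodule by (simp add: coboundaries_def D.im_def)
  moreover have "B (Suc n) \<subseteq> carrier (Z (Suc n))"
    using assms D.T_im by (auto simp: coboundaries_def cocycles_def)
  moreover have "Module.module L (Z (Suc n))"
    using cocycles_vectorspace by (simp add: vectorspace_def)
  ultimately show ?thesis by (simp add: submodule_def)
qed

lemma d0:
  assumes f: "f \<in> carrier (C 0)"
  shows "d 0 f = \<zero>\<^bsub>C (Suc 0)\<^esub>"
  unfolding coboundary_def cochains_simps
  using cochain_closed[OF f] by (intro restrict_ext) (auto simp: tuples_simps L.l_minus L.r_neg)

lemma d1:
  assumes f: "f \<in> carrier (C 1)" and "g \<in> carrier G" "h \<in> carrier G"
  shows "d 1 f [g, h] = f [h] \<ominus>\<^bsub>L\<^esub> f [g \<otimes>\<^bsub>G\<^esub> h] \<oplus>\<^bsub>L\<^esub> f [g]"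
proof -
  have "f [x] \<in> carrier L" if "x \<in> carrier G" for x
    using cochain_closed[OF f, of "[x]"] that by (simp add: Cons_in_tuples_simps)
  then show ?thesis
    using assms by (simp add: coboundary_def Cons_in_tuples_simps merge_at_def L.l_minus L.minus_eq lessThan_Suc)
qed

lemma d2:
  assumes f: "f \<in> carrier (C 2)" and "g \<in> carrier G" "h \<in> carrier G" "k \<in> carrier G"
  shows "d 2 f [g, h, k] = f [h, k] \<ominus>\<^bsub>L\<^esub> f [g \<otimes>\<^bsub>G\<^esub> h, k] \<oplus>\<^bsub>L\<^esub> f [g, h \<otimes>\<^bsub>G\<^esub> k] \<ominus>\<^bsub>L\<^esub> f [g, h]"
proof -
  have "f [x, y] \<in> carrier L" if "x \<in> carrier G" "y \<in> carrier G" for x y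
    using cochain_closed[OF f, of "[x, y]"] that by (simp add: Cons_in_tuples_simps)
  then show ?thesis
    using assms
    by (simp add: coboundary_def Cons_in_tuples_simps merge_at_def L.l_minus L.minus_eq lessThan_Suc L.a_ac)
qed

lemma d_closed: "f \<in> carrier (C n) \<Longrightarrow> d n f \<in> carrier (C (Suc n))"
proof -
  interpret D: linear_map L "C n" "C (Suc n)" "d n" by (rule coboundary_linear)
  show "f \<in> carrier (C n) \<Longrightarrow> d n f \<in> carrier (C (Suc n))" by (rule D.T_im)
qed

lemma zero_cochain: "xs \<in> tuples G n \<Longrightarrow> \<zero>\<^bsub>C n\<^esub> xs = \<zero>\<^bsub>L\<^esub>"
  by (simp add: cochains_simps)

lemma zero_cochain_closed: "\<zero>\<^bsub>C n\<^esub> \<in> carrier (C n)"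
  by (simp add: cochains_simps)

lemma d1_d0: "f \<in> carrier (C 0) \<Longrightarrow> d (Suc 0) (d 0 f) = \<zero>\<^bsub>C (Suc (Suc 0))\<^esub>"
proof -
  interpret D: linear_map L "C (Suc 0)" "C (Suc (Suc 0))" "d (Suc 0)" by (rule coboundary_linear)
  show "f \<in> carrier (C 0) \<Longrightarrow> ?thesis" using d0[of f] D.T0_is_0 by simp
qed

lemma d2_d1:
  assumes f: "f \<in> carrier (C 1)"
  shows "d 2 (d 1 f) = \<zero>\<^bsub>C 3\<^esub>"
proof (rule cochain_eqI)
  have df: "d 1 f \<in> carrier (C 2)" using d_closed[OF f] by (simp add: numeral_2_eq_2)
  show "d 2 (d 1 f) \<in> carrier (C 3)" using d_closed[OF df] by (simp add: numeral_3_eq_3 numeral_2_eq_2)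
  show "\<zero>\<^bsub>C 3\<^esub> \<in> carrier (C 3)" by (rule zero_cochain_closed)
  have cl: "f [x] \<in> carrier L" if "x \<in> carrier G" for x
    using cochain_closed[OF f, of "[x]"] that by (simp add: Cons_in_tuples_simps)
  fix xs assume xs: "xs \<in> tuples G 3"
  then obtain g h k where ghk: "g \<in> carrier G" "h \<in> carrier G" "k \<in> carrier G" "xs = [g, h, k]"
    by (auto simp: tuples_simps)
  then have "f [g] \<in> carrier L" "f [h] \<in> carrier L" "f [k] \<in> carrier L"
    "f [g \<otimes>\<^bsub>G\<^esub> h] \<in> carrier L" "f [h \<otimes>\<^bsub>G\<^esub> k] \<in> carrier L" "f [g \<otimes>\<^bsub>G\<^esub> (h \<otimes>\<^bsub>G\<^esub> k)] \<in> carrier L"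
    using cl by simp_all
  then have "d 2 (d 1 f) xs = \<zero>\<^bsub>L\<^esub>"
    using ghk by (simp add: d2[OF df] d1[OF f] G.m_assoc del: One_nat_def) (simp add: L.minus_eq L.minus_add L.a_ac L.r_neg L.r_neg1 L.r_neg2)
  then show "d 2 (d 1 f) xs = \<zero>\<^bsub>C 3\<^esub> xs" using xs by (simp add: zero_cochain)
qed


lemma cochain1_closed: "f \<in> carrier (C 1) \<Longrightarrow> g \<in> carrier G \<Longrightarrow> f [g] \<in> carrier L"
  using cochain_closed[of f 1 "[g]"] by (simp add: Cons_in_tuples_simps)

lemma tuples_1_cases:
  assumes "xs \<in> tuples G 1"
  obtains g where "g \<in> carrier G" "xs = [g]"
  using assms by (auto simp: tuples_simps)

lemma tuples_2_cases:
  assumes "xs \<in> tuples G 2"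
  obtains g h where "g \<in> carrier G" "h \<in> carrier G" "xs = [g, h]"
  using assms by (auto simp: tuples_simps)

lemma singleton_in_tuples: "[g] \<in> tuples G 1 \<longleftrightarrow> g \<in> carrier G"
  by (simp add: Cons_in_tuples_simps)

lemma function_cochain:
  "h \<in> carrier G \<rightarrow> carrier L \<Longrightarrow> (\<lambda>xs\<in>tuples G 1. h (hd xs)) \<in> carrier (C 1)"
  unfolding cochains_simps by (auto simp del: One_nat_def elim!: tuples_1_cases)

lemma d1_closed: "f \<in> carrier (C 1) \<Longrightarrow> d 1 f \<in> carrier (C 2)"
  using d_closed[of f 1] by (simp add: numeral_2_eq_2)

text \<open>A \<open>1\<close>-cocycle is a homomorphism to the additive group of \<open>L\<close>.\<close>

lemma cocycles_1_iff:
  "f \<in> carrier (Z 1) \<longleftrightarrow> f \<in> carrier (C 1) \<and>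
    (\<forall>g\<in>carrier G. \<forall>h\<in>carrier G. f [g \<otimes>\<^bsub>G\<^esub> h] = f [g] \<oplus>\<^bsub>L\<^esub> f [h])"
proof -
  have "d 1 f = \<zero>\<^bsub>C 2\<^esub> \<longleftrightarrow> (\<forall>g\<in>carrier G. \<forall>h\<in>carrier G. f [g \<otimes>\<^bsub>G\<^esub> h] = f [g] \<oplus>\<^bsub>L\<^esub> f [h])"
    if f: "f \<in> carrier (C 1)"
  proof -
    have "d 1 f = \<zero>\<^bsub>C 2\<^esub> \<longleftrightarrow> (\<forall>xs\<in>tuples G 2. d 1 f xs = \<zero>\<^bsub>L\<^esub>)"
      using cochain_eqI[OF d1_closed[OF f] zero_cochain_closed] by (auto simp: zero_cochain)
    also have "\<dots> \<longleftrightarrow> (\<forall>g\<in>carrier G. \<forall>h\<in>carrier G. d 1 f [g, h] = \<zero>\<^bsub>L\<^esub>)"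
      by (auto simp: tuples_simps)
    also have "\<dots> \<longleftrightarrow> (\<forall>g\<in>carrier G. \<forall>h\<in>carrier G. f [g \<otimes>\<^bsub>G\<^esub> h] = f [g] \<oplus>\<^bsub>L\<^esub> f [h])"
    proof (intro ball_cong HOL.refl)
      fix g h assume gh: "g \<in> carrier G" "h \<in> carrier G"
      then have cl: "f [g] \<in> carrier L" "f [h] \<in> carrier L" "f [g \<otimes>\<^bsub>G\<^esub> h] \<in> carrier L"
        using cochain1_closed[OF f] by auto
      have "d 1 f [g, h] = (f [g] \<oplus>\<^bsub>L\<^esub> f [h]) \<ominus>\<^bsub>L\<^esub> f [g \<otimes>\<^bsub>G\<^esub> h]"
        unfolding d1[OF f gh] using cl by (simp add: L.minus_eq L.a_ac)
      then show "d 1 f [g, h] = \<zero>\<^bsub>L\<^esub> \<longleftrightarrow> f [g \<otimes>\<^bsub>G\<^esub> h] = f [g] \<oplus>\<^bsub>L\<^esub> f [h]"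
        using cl L.minus_other_side[of "f [g] \<oplus>\<^bsub>L\<^esub> f [h]" "f [g \<otimes>\<^bsub>G\<^esub> h]"] by auto
    qed
    finally show ?thesis .
  qed
  moreover have "f \<in> carrier (Z 1) \<longleftrightarrow> f \<in> carrier (C 1) \<and> d 1 f = \<zero>\<^bsub>C 2\<^esub>"
    by (simp add: cocycles_def numeral_2_eq_2)
  ultimately show ?thesis by blast
qed

lemma cocycle_1_cochain: "f \<in> carrier (Z 1) \<Longrightarrow> f \<in> carrier (C 1)"
  by (simp add: cocycles_1_iff del: One_nat_def)

lemma cocycle_1_closed: "f \<in> carrier (Z 1) \<Longrightarrow> g \<in> carrier G \<Longrightarrow> f [g] \<in> carrier L"
  using cochain1_closed cocycle_1_cochain by blast

lemma cocycle_1_mult: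
  "f \<in> carrier (Z 1) \<Longrightarrow> g \<in> carrier G \<Longrightarrow> h \<in> carrier G \<Longrightarrow> f [g \<otimes>\<^bsub>G\<^esub> h] = f [g] \<oplus>\<^bsub>L\<^esub> f [h]"
  by (simp add: cocycles_1_iff del: One_nat_def)

text \<open>With trivial coefficients the two terms of the coboundary of a \<open>0\<close>-cochain cancel. Hence the
  elements of \<open>H\<^sup>1\<close> are singletons of \<open>1\<close>-cocycles.\<close>

lemma coboundaries_1: "B 1 = {\<zero>\<^bsub>C 1\<^esub>}"
proof -
  have "B 1 = d 0 ` carrier (C 0)" by (simp add: coboundaries_def)
  also have "\<dots> = (\<lambda>_. \<zero>\<^bsub>C 1\<^esub>) ` carrier (C 0)" by (rule image_cong) (simp_all add: d0)
  finally show ?thesis using zero_cochain_closed[of 0] by auto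
qed

lemma coboundaries_1_submodule: "submodule L (B 1) (Z 1)"
  using coboundaries_submodule[of 0] d1_d0 by simp

lemma coboundaries_2_submodule: "submodule L (B 2) (Z 2)"
  using coboundaries_submodule[of 1] d2_d1 by (simp add: numeral_2_eq_2 numeral_3_eq_3)

lemma cohomology_1_vectorspace: "vectorspace L (cohomology L G 1)"
  unfolding cohomology_def
  by (rule vectorspace.quotient_is_vectorspace[OF cocycles_vectorspace coboundaries_1_submodule])

lemma cohomology_2_vectorspace: "vectorspace L (cohomology L G 2)"
  unfolding cohomology_def
  by (rule vectorspace.quotient_is_vectorspace[OF cocycles_vectorspace coboundaries_2_submodule])

lemma cocycles_module: "Module.module L (Z n)"
  using cocycles_vectorspace by (simp add: vectorspace_def)

lemma coset_1:
  assumes f: "f \<in> carrier (Z 1)"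
  shows "B 1 +>\<^bsub>Z 1\<^esub> f = {f}"
proof -
  interpret Z1: Module.module L "Z 1" by (rule cocycles_module)
  show ?thesis using Z1.M.l_zero[OF f] by (simp add: coboundaries_1 a_r_coset_def' del: One_nat_def)
qed

lemma cohomology_1_simps:
  shows cohomology_1_carrier: "carrier (cohomology L G 1) = (\<lambda>f. {f}) ` carrier (Z 1)"
    and cohomology_1_zero: "\<zero>\<^bsub>cohomology L G 1\<^esub> = {\<zero>\<^bsub>C 1\<^esub>}"
    and cohomology_1_add: "f \<in> carrier (Z 1) \<Longrightarrow> g \<in> carrier (Z 1) \<Longrightarrow>
      {f} \<oplus>\<^bsub>cohomology L G 1\<^esub> {g} = {f \<oplus>\<^bsub>C 1\<^esub> g}"
    and cohomology_1_smult: "c \<in> carrier L \<Longrightarrow> f \<in> carrier (Z 1) \<Longrightarrow>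
      c \<odot>\<^bsub>cohomology L G 1\<^esub> {f} = {c \<odot>\<^bsub>C 1\<^esub> f}"
proof -
  interpret Z1: Module.module L "Z 1" by (rule cocycles_module)
  note N = coboundaries_1_submodule
  show "carrier (cohomology L G 1) = (\<lambda>f. {f}) ` carrier (Z 1)"
    unfolding cohomology_def Z1.quotient_carrier[OF N] by (rule image_cong) (simp_all only: coset_1)
  show "\<zero>\<^bsub>cohomology L G 1\<^esub> = {\<zero>\<^bsub>C 1\<^esub>}"
    unfolding cohomology_def Z1.quotient_zero[OF N] by (rule coboundaries_1)
  show "{f} \<oplus>\<^bsub>cohomology L G 1\<^esub> {g} = {f \<oplus>\<^bsub>C 1\<^esub> g}" if f: "f \<in> carrier (Z 1)" and g: "g \<in> carrier (Z 1)"
    using Z1.quotient_add[OF N f g] coset_1[OF f] coset_1[OF g] coset_1[OF Z1.M.a_closed[OF f g]]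
    by (simp add: cohomology_def del: One_nat_def)
  show "c \<odot>\<^bsub>cohomology L G 1\<^esub> {f} = {c \<odot>\<^bsub>C 1\<^esub> f}" if c: "c \<in> carrier L" and f: "f \<in> carrier (Z 1)"
    using Z1.quotient_smult[OF N c f] coset_1[OF f] coset_1[OF Z1.smult_closed[OF c f]]
    by (simp add: cohomology_def del: One_nat_def)
qed

abbreviation cc :: "('g list \<Rightarrow> 'l) \<Rightarrow> ('g list \<Rightarrow> 'l) \<Rightarrow> ('g list \<Rightarrow> 'l)" where
  "cc a b \<equiv> cup_cochain L G 1 1 a b"

lemma cup_cochain_1_1:
  "g \<in> carrier G \<Longrightarrow> h \<in> carrier G \<Longrightarrow> cc a b [g, h] = a [g] \<otimes>\<^bsub>L\<^esub> b [h]"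
  by (simp add: cup_cochain_def Cons_in_tuples_simps)

lemma cup_cochain_1_1_closed:
  assumes a: "a \<in> carrier (C 1)" and b: "b \<in> carrier (C 1)"
  shows "cc a b \<in> carrier (C 2)"
  unfolding cochains_simps
proof (rule PiE_I)
  fix xs assume "xs \<in> tuples G 2"
  then obtain g h where "g \<in> carrier G" "h \<in> carrier G" "xs = [g, h]" by (rule tuples_2_cases)
  then show "cc a b xs \<in> carrier L"
    using cochain1_closed[OF a] cochain1_closed[OF b] by (simp add: cup_cochain_1_1 del: One_nat_def)
qed (simp add: cup_cochain_def numeral_2_eq_2)

lemma cup_cochain_1_1_cocycle:
  assumes a: "a \<in> carrier (Z 1)" and b: "b \<in> carrier (Z 1)"
  shows "cc a b \<in> carrier (Z 2)"
proof -
  note ab = cup_cochain_1_1_closed[OF cocycle_1_cochain[OF a] cocycle_1_cochain[OF b]]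
  have "d 2 (cc a b) = \<zero>\<^bsub>C 3\<^esub>"
  proof (rule cochain_eqI)
    show "d 2 (cc a b) \<in> carrier (C 3)" using d_closed[OF ab] by (simp add: numeral_3_eq_3 numeral_2_eq_2)
    show "\<zero>\<^bsub>C 3\<^esub> \<in> carrier (C 3)" by (rule zero_cochain_closed)
    fix xs assume xs: "xs \<in> tuples G 3"
    then obtain g h k where ghk: "g \<in> carrier G" "h \<in> carrier G" "k \<in> carrier G" "xs = [g, h, k]"
      by (auto simp: tuples_simps)
    then have "a [g] \<in> carrier L" "a [h] \<in> carrier L" "b [h] \<in> carrier L" "b [k] \<in> carrier L"
      using cocycle_1_closed a b by blast+
    then have "d 2 (cc a b) xs = \<zero>\<^bsub>L\<^esub>"
      using ghk
      by (simp add: d2[OF ab] cup_cochain_1_1 cocycle_1_mult[OF a] cocycle_1_mult[OF b] del: One_nat_def)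
        (simp add: L.minus_eq L.minus_add L.l_distr L.r_distr L.a_ac L.r_neg L.r_neg1 L.r_neg2)
    then show "d 2 (cc a b) xs = \<zero>\<^bsub>C 3\<^esub> xs" using xs by (simp add: zero_cochain)
  qed
  then show ?thesis using ab by (simp add: cocycles_def numeral_3_eq_3 numeral_2_eq_2)
qed

lemma cup_singletons: "cup L G 1 1 {a} {b} = B 2 +>\<^bsub>Z 2\<^esub> cc a b"
  by (simp add: cup_def del: One_nat_def)

text \<open>The condition on \<open>f\<close> is the equation \<open>\<delta>f = a \<smile> b\<close> of cochains, solved for the value at a product.\<close>

lemma cup_eq_zero_iff:
  assumes a: "a \<in> carrier (Z 1)" and b: "b \<in> carrier (Z 1)"
  shows "cup L G 1 1 {a} {b} = \<zero>\<^bsub>cohomology L G 2\<^esub> \<longleftrightarrow>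
    (\<exists>f\<in>carrier (C 1). \<forall>g\<in>carrier G. \<forall>h\<in>carrier G.
      f [g \<otimes>\<^bsub>G\<^esub> h] = f [g] \<oplus>\<^bsub>L\<^esub> f [h] \<ominus>\<^bsub>L\<^esub> a [g] \<otimes>\<^bsub>L\<^esub> b [h])"
proof -
  interpret Z2: Module.module L "Z 2" by (rule cocycles_module)
  note N = coboundaries_2_submodule
  note ab = cup_cochain_1_1_closed[OF cocycle_1_cochain[OF a] cocycle_1_cochain[OF b]]
  have B2: "B 2 = d 1 ` carrier (C 1)" by (simp add: coboundaries_def numeral_2_eq_2)
  have "cup L G 1 1 {a} {b} = \<zero>\<^bsub>cohomology L G 2\<^esub> \<longleftrightarrow> cc a b \<in> B 2"
    using Z2.coset_eq_submodule_iff[OF N cup_cochain_1_1_cocycle[OF a b]] Z2.quotient_zero[OF N]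
    by (simp add: cup_singletons cohomology_def del: One_nat_def)
  also have "\<dots> \<longleftrightarrow> (\<exists>f\<in>carrier (C 1). d 1 f = cc a b)"
    unfolding B2 image_iff by (metis (no_types))
  also have "\<dots> \<longleftrightarrow> (\<exists>f\<in>carrier (C 1). \<forall>g\<in>carrier G. \<forall>h\<in>carrier G.
      f [g \<otimes>\<^bsub>G\<^esub> h] = f [g] \<oplus>\<^bsub>L\<^esub> f [h] \<ominus>\<^bsub>L\<^esub> a [g] \<otimes>\<^bsub>L\<^esub> b [h])"
  proof (intro bex_cong HOL.refl)
    fix f assume f: "f \<in> carrier (C 1)"
    have "d 1 f = cc a b \<longleftrightarrow> (\<forall>xs\<in>tuples G 2. d 1 f xs = cc a b xs)"
      using cochain_eqI[OF d1_closed[OF f] ab] by auto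
    also have "\<dots> \<longleftrightarrow> (\<forall>g\<in>carrier G. \<forall>h\<in>carrier G. d 1 f [g, h] = cc a b [g, h])"
      by (auto simp: tuples_simps)
    also have "\<dots> \<longleftrightarrow> (\<forall>g\<in>carrier G. \<forall>h\<in>carrier G.
      f [g \<otimes>\<^bsub>G\<^esub> h] = f [g] \<oplus>\<^bsub>L\<^esub> f [h] \<ominus>\<^bsub>L\<^esub> a [g] \<otimes>\<^bsub>L\<^esub> b [h])"
    proof (intro ball_cong HOL.refl)
      fix g h assume gh: "g \<in> carrier G" "h \<in> carrier G"
      let ?x = "f [g \<otimes>\<^bsub>G\<^esub> h]" and ?s = "f [g] \<oplus>\<^bsub>L\<^esub> f [h]" and ?p = "a [g] \<otimes>\<^bsub>L\<^esub> b [h]"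
      have cl: "f [g] \<in> carrier L" "f [h] \<in> carrier L" "?x \<in> carrier L" "?p \<in> carrier L"
        using gh cochain1_closed[OF f] cocycle_1_closed a b by auto
      have "d 1 f [g, h] = ?s \<ominus>\<^bsub>L\<^esub> ?x"
        unfolding d1[OF f gh] using cl by (simp add: L.minus_eq L.a_ac)
      moreover have "?s \<ominus>\<^bsub>L\<^esub> ?x = ?p \<longleftrightarrow> ?x = ?s \<ominus>\<^bsub>L\<^esub> ?p"
      proof
        assume "?s \<ominus>\<^bsub>L\<^esub> ?x = ?p"
        then have "?s \<ominus>\<^bsub>L\<^esub> ?p = ?s \<ominus>\<^bsub>L\<^esub> (?s \<ominus>\<^bsub>L\<^esub> ?x)" by simp
        also have "\<dots> = ?x" using cl by (simp add: L.minus_eq L.minus_add L.a_ac L.r_neg2 L.r_neg1)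
        finally show "?x = ?s \<ominus>\<^bsub>L\<^esub> ?p" by simp
      next
        assume "?x = ?s \<ominus>\<^bsub>L\<^esub> ?p"
        then have "?s \<ominus>\<^bsub>L\<^esub> ?x = ?s \<ominus>\<^bsub>L\<^esub> (?s \<ominus>\<^bsub>L\<^esub> ?p)" by simp
        also have "\<dots> = ?p" using cl by (simp add: L.minus_eq L.minus_add L.a_ac L.r_neg2 L.r_neg1)
        finally show "?s \<ominus>\<^bsub>L\<^esub> ?x = ?p" .
      qed
      ultimately show "d 1 f [g, h] = cc a b [g, h] \<longleftrightarrow> ?x = ?s \<ominus>\<^bsub>L\<^esub> ?p"
        using gh by (simp only: cup_cochain_1_1)
    qed
    finally show "d 1 f = cc a b \<longleftrightarrow> (\<forall>g\<in>carrier G. \<forall>h\<in>carrier G.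
      f [g \<otimes>\<^bsub>G\<^esub> h] = f [g] \<oplus>\<^bsub>L\<^esub> f [h] \<ominus>\<^bsub>L\<^esub> a [g] \<otimes>\<^bsub>L\<^esub> b [h])" .
  qed
  finally show ?thesis .
qed


lemma cup_cochain_add_left:
  assumes a: "a \<in> carrier (Z 1)" and a': "a' \<in> carrier (Z 1)" and b: "b \<in> carrier (Z 1)"
  shows "cc (a \<oplus>\<^bsub>C 1\<^esub> a') b = cc a b \<oplus>\<^bsub>C 2\<^esub> cc a' b"
  unfolding cup_cochain_def[of L G 1 1] cochains_simps one_add_one
proof (rule restrict_ext)
  fix xs assume "xs \<in> tuples G 2"
  then obtain g h where "g \<in> carrier G" "h \<in> carrier G" "xs = [g, h]" by (rule tuples_2_cases)
  then show "(\<lambda>v\<in>tuples G 1. a v \<oplus>\<^bsub>L\<^esub> a' v) (take 1 xs) \<otimes>\<^bsub>L\<^esub> b (drop 1 xs)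
    = (\<lambda>xs\<in>tuples G 2. a (take 1 xs) \<otimes>\<^bsub>L\<^esub> b (drop 1 xs)) xs
      \<oplus>\<^bsub>L\<^esub> (\<lambda>xs\<in>tuples G 2. a' (take 1 xs) \<otimes>\<^bsub>L\<^esub> b (drop 1 xs)) xs"
    using cocycle_1_closed[OF a] cocycle_1_closed[OF a'] cocycle_1_closed[OF b]
    by (simp add: Cons_in_tuples_simps L.l_distr)
qed

lemma cup_cochain_add_right:
  assumes a: "a \<in> carrier (Z 1)" and b: "b \<in> carrier (Z 1)" and b': "b' \<in> carrier (Z 1)"
  shows "cc a (b \<oplus>\<^bsub>C 1\<^esub> b') = cc a b \<oplus>\<^bsub>C 2\<^esub> cc a b'"
  unfolding cup_cochain_def[of L G 1 1] cochains_simps one_add_one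
proof (rule restrict_ext)
  fix xs assume "xs \<in> tuples G 2"
  then obtain g h where "g \<in> carrier G" "h \<in> carrier G" "xs = [g, h]" by (rule tuples_2_cases)
  then show "a (take 1 xs) \<otimes>\<^bsub>L\<^esub> (\<lambda>v\<in>tuples G 1. b v \<oplus>\<^bsub>L\<^esub> b' v) (drop 1 xs)
    = (\<lambda>xs\<in>tuples G 2. a (take 1 xs) \<otimes>\<^bsub>L\<^esub> b (drop 1 xs)) xs
      \<oplus>\<^bsub>L\<^esub> (\<lambda>xs\<in>tuples G 2. a (take 1 xs) \<otimes>\<^bsub>L\<^esub> b' (drop 1 xs)) xs"
    using cocycle_1_closed[OF a] cocycle_1_closed[OF b] cocycle_1_closed[OF b']
    by (simp add: Cons_in_tuples_simps L.r_distr)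
qed

lemma cup_cochain_smult:
  assumes c: "c \<in> carrier L" and a: "a \<in> carrier (Z 1)" and b: "b \<in> carrier (Z 1)"
  shows "cc (c \<odot>\<^bsub>C 1\<^esub> a) b = c \<odot>\<^bsub>C 2\<^esub> cc a b" "cc a (c \<odot>\<^bsub>C 1\<^esub> b) = c \<odot>\<^bsub>C 2\<^esub> cc a b"
  unfolding cup_cochain_def[of L G 1 1] cochains_simps one_add_one
proof (safe intro!: restrict_ext)
  fix xs assume "xs \<in> tuples G 2"
  then obtain g h where gh: "g \<in> carrier G" "h \<in> carrier G" "xs = [g, h]" by (rule tuples_2_cases)
  then show "(\<lambda>v\<in>tuples G 1. c \<otimes>\<^bsub>L\<^esub> a v) (take 1 xs) \<otimes>\<^bsub>L\<^esub> b (drop 1 xs)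
    = c \<otimes>\<^bsub>L\<^esub> (\<lambda>xs\<in>tuples G 2. a (take 1 xs) \<otimes>\<^bsub>L\<^esub> b (drop 1 xs)) xs"
    using c cocycle_1_closed[OF a] cocycle_1_closed[OF b]
    by (simp add: Cons_in_tuples_simps L.m_assoc)
  show "a (take 1 xs) \<otimes>\<^bsub>L\<^esub> (\<lambda>v\<in>tuples G 1. c \<otimes>\<^bsub>L\<^esub> b v) (drop 1 xs)
    = c \<otimes>\<^bsub>L\<^esub> (\<lambda>xs\<in>tuples G 2. a (take 1 xs) \<otimes>\<^bsub>L\<^esub> b (drop 1 xs)) xs"
    using gh c cocycle_1_closed[OF a] cocycle_1_closed[OF b]
    by (simp add: Cons_in_tuples_simps L.m_lcomm)
qed

lemma cup_cochain_anticomm: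
  assumes a: "a \<in> carrier (Z 1)" and b: "b \<in> carrier (Z 1)"
  shows "cc a b \<oplus>\<^bsub>C 2\<^esub> cc b a \<in> B 2"
proof -
  interpret C2: vectorspace L "C 2" by (rule cochains_vectorspace)
  \<comment> \<open>\<open>ab\<close> fails to be additive by exactly the mixed terms \<open>a(g) b(h) + a(h) b(g)\<close>\<close>
  let ?f = "\<lambda>xs\<in>tuples G 1. \<ominus>\<^bsub>L\<^esub> (a xs \<otimes>\<^bsub>L\<^esub> b xs)"
  have f: "?f \<in> carrier (C 1)"
    using cochain_closed[OF cocycle_1_cochain[OF a]] cochain_closed[OF cocycle_1_cochain[OF b]]
    by (auto simp: cochains_simps simp del: One_nat_def)
  have fg: "?f [g] = \<ominus>\<^bsub>L\<^esub> (a [g] \<otimes>\<^bsub>L\<^esub> b [g])" if "g \<in> carrier G" for g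
    using that by (simp add: Cons_in_tuples_simps)
  have ab: "cc a b \<in> carrier (C 2)" "cc b a \<in> carrier (C 2)"
    using cup_cochain_1_1_closed cocycle_1_cochain a b by blast+
  have "d 1 ?f = cc a b \<oplus>\<^bsub>C 2\<^esub> cc b a"
  proof (rule cochain_eqI[OF d1_closed[OF f] C2.M.a_closed[OF ab]])
    fix xs assume xs: "xs \<in> tuples G 2"
    then obtain g h where gh: "g \<in> carrier G" "h \<in> carrier G" "xs = [g, h]" by (rule tuples_2_cases)
    have cl: "a [g] \<in> carrier L" "a [h] \<in> carrier L" "b [g] \<in> carrier L" "b [h] \<in> carrier L"
      using gh cocycle_1_closed a b by blast+
    have "(cc a b \<oplus>\<^bsub>C 2\<^esub> cc b a) xs = a [g] \<otimes>\<^bsub>L\<^esub> b [h] \<oplus>\<^bsub>L\<^esub> b [g] \<otimes>\<^bsub>L\<^esub> a [h]"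
      using xs gh by (simp add: cochains_simps cup_cochain_1_1 del: One_nat_def)
    moreover have "d 1 ?f xs = \<ominus>\<^bsub>L\<^esub> (a [h] \<otimes>\<^bsub>L\<^esub> b [h])
        \<ominus>\<^bsub>L\<^esub> \<ominus>\<^bsub>L\<^esub> ((a [g] \<oplus>\<^bsub>L\<^esub> a [h]) \<otimes>\<^bsub>L\<^esub> (b [g] \<oplus>\<^bsub>L\<^esub> b [h])) \<oplus>\<^bsub>L\<^esub> \<ominus>\<^bsub>L\<^esub> (a [g] \<otimes>\<^bsub>L\<^esub> b [g])"
      unfolding gh(3) d1[OF f gh(1,2)]
      by (simp only: fg gh G.m_closed cocycle_1_mult[OF a gh(1,2)] cocycle_1_mult[OF b gh(1,2)])
    moreover have "\<dots> = a [g] \<otimes>\<^bsub>L\<^esub> b [h] \<oplus>\<^bsub>L\<^esub> b [g] \<otimes>\<^bsub>L\<^esub> a [h]"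
    proof -
      have "p \<oplus>\<^bsub>L\<^esub> (q \<oplus>\<^bsub>L\<^esub> (r \<oplus>\<^bsub>L\<^esub> \<ominus>\<^bsub>L\<^esub> p)) = q \<oplus>\<^bsub>L\<^esub> r"
        if "p \<in> carrier L" "q \<in> carrier L" "r \<in> carrier L" for p q r
      proof -
        have "p \<oplus>\<^bsub>L\<^esub> (q \<oplus>\<^bsub>L\<^esub> (r \<oplus>\<^bsub>L\<^esub> \<ominus>\<^bsub>L\<^esub> p)) = (p \<oplus>\<^bsub>L\<^esub> \<ominus>\<^bsub>L\<^esub> p) \<oplus>\<^bsub>L\<^esub> (q \<oplus>\<^bsub>L\<^esub> r)"
          using that by (simp only: L.a_ac L.a_closed L.a_inv_closed)
        then show ?thesis using that by (simp add: L.r_neg)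
      qed
      then show ?thesis
        using cl by (simp add: L.minus_eq L.minus_add L.l_distr L.r_distr L.a_ac L.m_ac L.r_neg L.r_neg1 L.r_neg2)
    qed
    ultimately show "d 1 ?f xs = (cc a b \<oplus>\<^bsub>C 2\<^esub> cc b a) xs" by simp
  qed
  then show ?thesis using f by (simp add: coboundaries_def numeral_2_eq_2) (metis image_eqI)
qed

lemma cup_pairing:
  assumes fd: "vectorspace.fin_dim L (cohomology L G 1)"
  shows "pairing L (cohomology L G 1) (cohomology L G 2) (cup L G 1 1)"
proof -
  interpret Z1: vectorspace L "Z 1" by (rule cocycles_vectorspace)
  interpret Z2: vectorspace L "Z 2" by (rule cocycles_vectorspace)
  interpret H2: vectorspace L "cohomology L G 2" by (rule cohomology_2_vectorspace)
  note N = coboundaries_2_submodule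
  note cls = cup_cochain_1_1_cocycle
  let ?q = "cup L G 1 1" and ?H1 = "cohomology L G 1" and ?H2 = "cohomology L G 2"
  have closed: "?q {a} {b} \<in> carrier ?H2" if "a \<in> carrier (Z 1)" "b \<in> carrier (Z 1)" for a b
    using cls[OF that] by (simp add: cup_singletons cohomology_def Z2.quotient_carrier[OF N] del: One_nat_def)
  have add: "B 2 +>\<^bsub>Z 2\<^esub> (x \<oplus>\<^bsub>C 2\<^esub> y) = (B 2 +>\<^bsub>Z 2\<^esub> x) \<oplus>\<^bsub>?H2\<^esub> (B 2 +>\<^bsub>Z 2\<^esub> y)"
    if "x \<in> carrier (Z 2)" "y \<in> carrier (Z 2)" for x y
    using Z2.quotient_add[OF N that] by (simp add: cohomology_def)
  have smult: "B 2 +>\<^bsub>Z 2\<^esub> (c \<odot>\<^bsub>C 2\<^esub> x) = c \<odot>\<^bsub>?H2\<^esub> (B 2 +>\<^bsub>Z 2\<^esub> x)"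
    if "c \<in> carrier L" "x \<in> carrier (Z 2)" for c x
    using Z2.quotient_smult[OF N that] by (simp add: cohomology_def)
  have anti: "?q {a} {b} = \<ominus>\<^bsub>?H2\<^esub> ?q {b} {a}" if ab: "a \<in> carrier (Z 1)" "b \<in> carrier (Z 1)" for a b
  proof -
    have c: "cc a b \<oplus>\<^bsub>C 2\<^esub> cc b a \<in> carrier (Z 2)"
      using Z2.M.a_closed[OF cls[OF ab] cls[OF ab(2,1)]] by simp
    have "?q {a} {b} \<oplus>\<^bsub>?H2\<^esub> ?q {b} {a} = B 2 +>\<^bsub>Z 2\<^esub> (cc a b \<oplus>\<^bsub>C 2\<^esub> cc b a)"
      unfolding cup_singletons using add[OF cls[OF ab] cls[OF ab(2,1)]] by simp
    also have "\<dots> = \<zero>\<^bsub>?H2\<^esub>"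
      using Z2.coset_eq_submodule_iff[OF N c] cup_cochain_anticomm[OF ab] Z2.quotient_zero[OF N]
      by (simp add: cohomology_def del: One_nat_def)
    finally show ?thesis
      using H2.M.minus_equality[OF _ closed[OF ab(2,1)] closed[OF ab]] by simp
  qed
  show ?thesis
  proof (intro pairing.intro pairing_axioms.intro cohomology_1_vectorspace cohomology_2_vectorspace fd)
    show "(\<forall>u\<in>carrier ?H1. \<forall>v\<in>carrier ?H1. ?q u v = ?q v u) \<or>
      (\<forall>u\<in>carrier ?H1. \<forall>v\<in>carrier ?H1. ?q u v = \<ominus>\<^bsub>?H2\<^esub> ?q v u)"
      unfolding cohomology_1_carrier using anti by blast
  next
    fix u v assume "u \<in> carrier ?H1" "v \<in> carrier ?H1"
    then show "?q u v \<in> carrier ?H2" unfolding cohomology_1_carrier using closed by blast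
  next
    fix u u' v assume "u \<in> carrier ?H1" "u' \<in> carrier ?H1" "v \<in> carrier ?H1"
    then obtain a a' b where "a \<in> carrier (Z 1)" "a' \<in> carrier (Z 1)" "b \<in> carrier (Z 1)"
      "u = {a}" "u' = {a'}" "v = {b}" unfolding cohomology_1_carrier by blast
    then show "?q (u \<oplus>\<^bsub>?H1\<^esub> u') v = ?q u v \<oplus>\<^bsub>?H2\<^esub> ?q u' v"
      "?q v (u \<oplus>\<^bsub>?H1\<^esub> u') = ?q v u \<oplus>\<^bsub>?H2\<^esub> ?q v u'"
      using cls by (simp_all only: cohomology_1_add cup_singletons cup_cochain_add_left cup_cochain_add_right add)
  next
    fix c u v assume "c \<in> carrier L" "u \<in> carrier ?H1" "v \<in> carrier ?H1"
    then obtain a b where "c \<in> carrier L" "a \<in> carrier (Z 1)" "b \<in> carrier (Z 1)"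
      "u = {a}" "v = {b}" unfolding cohomology_1_carrier by blast
    then show "?q (c \<odot>\<^bsub>?H1\<^esub> u) v = c \<odot>\<^bsub>?H2\<^esub> ?q u v" "?q u (c \<odot>\<^bsub>?H1\<^esub> v) = c \<odot>\<^bsub>?H2\<^esub> ?q u v"
      using cls by (simp_all only: cohomology_1_smult cup_singletons cup_cochain_smult smult)
  qed
qed

end

section \<open>Cohomology of right-angled Artin groups\<close>

text \<open>The Heisenberg group with the sign convention for which the last coordinate of a homomorphism
  with first coordinates \<open>a\<close>, \<open>b\<close> has coboundary \<open>a \<smile> b\<close>.\<close>

definition heisenberg :: "('l, 'm) ring_scheme \<Rightarrow> ('l \<times> 'l \<times> 'l) monoid" where
  "heisenberg L =
     \<lparr> carrier = carrier L \<times> carrier L \<times> carrier L,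
       mult = (\<lambda>(x, y, z) (x', y', z').
         (x \<oplus>\<^bsub>L\<^esub> x', y \<oplus>\<^bsub>L\<^esub> y', z \<oplus>\<^bsub>L\<^esub> z' \<ominus>\<^bsub>L\<^esub> x \<otimes>\<^bsub>L\<^esub> y')),
       one = (\<zero>\<^bsub>L\<^esub>, \<zero>\<^bsub>L\<^esub>, \<zero>\<^bsub>L\<^esub>) \<rparr>"

lemma (in cring) group_heisenberg: "group (heisenberg R)"
proof (rule groupI)
  let ?H = "heisenberg R"
  have mult: "(x, y, z) \<otimes>\<^bsub>?H\<^esub> (x', y', z') = (x \<oplus> x', y \<oplus> y', z \<oplus> z' \<ominus> x \<otimes> y')" for x y z x' y' z'
    by (simp add: heisenberg_def)
  have one: "\<one>\<^bsub>?H\<^esub> = (\<zero>, \<zero>, \<zero>)" by (simp add: heisenberg_def)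
  have car: "carrier ?H = carrier R \<times> carrier R \<times> carrier R" by (simp add: heisenberg_def)
  show "\<one>\<^bsub>?H\<^esub> \<in> carrier ?H" by (simp add: one car)
  fix g assume "g \<in> carrier ?H"
  then obtain x y z where g: "g = (x, y, z)" "x \<in> carrier R" "y \<in> carrier R" "z \<in> carrier R"
    by (auto simp: car)
  show "\<one>\<^bsub>?H\<^esub> \<otimes>\<^bsub>?H\<^esub> g = g" using g by (simp add: one mult minus_eq)
  show "\<exists>k\<in>carrier ?H. k \<otimes>\<^bsub>?H\<^esub> g = \<one>\<^bsub>?H\<^esub>"
  proof
    show "(\<ominus> x, \<ominus> y, \<ominus> z \<ominus> x \<otimes> y) \<in> carrier ?H" using g by (simp add: car minus_eq)
    show "(\<ominus> x, \<ominus> y, \<ominus> z \<ominus> x \<otimes> y) \<otimes>\<^bsub>?H\<^esub> g = \<one>\<^bsub>?H\<^esub>"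
      using g by (simp add: one mult minus_eq l_minus l_neg a_ac r_neg r_neg1 r_neg2)
  qed
  fix g' assume "g' \<in> carrier ?H"
  then obtain x' y' z' where g': "g' = (x', y', z')" "x' \<in> carrier R" "y' \<in> carrier R" "z' \<in> carrier R"
    by (auto simp: car)
  show "g \<otimes>\<^bsub>?H\<^esub> g' \<in> carrier ?H" using g g' by (simp add: car mult)
  fix g'' assume "g'' \<in> carrier ?H"
  then obtain x'' y'' z'' where g'': "g'' = (x'', y'', z'')" "x'' \<in> carrier R" "y'' \<in> carrier R" "z'' \<in> carrier R"
    by (auto simp: car)
  show "g \<otimes>\<^bsub>?H\<^esub> g' \<otimes>\<^bsub>?H\<^esub> g'' = g \<otimes>\<^bsub>?H\<^esub> (g' \<otimes>\<^bsub>?H\<^esub> g'')"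
    using g g' g'' by (simp add: mult minus_eq minus_add l_distr r_distr a_ac)
qed

locale raag_cohomology = L: field L + fin_simplicial_graph \<Gamma>
  for L :: "('l, 'm) ring_scheme" and \<Gamma> :: "'v simplicial_graph"
begin

abbreviation relators :: "'v word set" where
  "relators \<equiv> {commutator_word v w | v w. {v, w} \<in> Edge \<Gamma>}"

sublocale P: presentation "Vert \<Gamma>" relators
  using Edge_subset by unfold_locales (fastforce simp: commutator_word_def)

lemma raag_eq: "raag \<Gamma> = P.P"
  by (simp add: raag_def)

sublocale bar_complex L "raag \<Gamma>"
proof -
  show "bar_complex L (raag \<Gamma>)"
    using P.group_P L.field_axioms by (simp add: bar_complex_def raag_eq)
qed

lemma gen_closed: "v \<in> Vert \<Gamma> \<Longrightarrow> P.gen v \<in> carrier (raag \<Gamma>)"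
  by (simp add: raag_eq)

text \<open>As words, \<open>v w\<close> arises from \<open>v w v\<inverse> w\<inverse> w v\<close> by two cancellations, and \<open>w v\<close> by deleting the relator.\<close>

lemma adjacent_gens_commute:
  assumes e: "{v, w} \<in> Edge \<Gamma>"
  shows "P.gen v \<otimes>\<^bsub>raag \<Gamma>\<^esub> P.gen w = P.gen w \<otimes>\<^bsub>raag \<Gamma>\<^esub> P.gen v"
proof -
  let ?c = "presentation_cong (Vert \<Gamma>) relators"
  let ?v = "(v, True)" and ?v' = "(v, False)" and ?w = "(w, True)" and ?w' = "(w, False)"
  have vw: "v \<in> Vert \<Gamma>" "w \<in> Vert \<Gamma>" using Edge_subset[OF e] by auto
  have "([] @ commutator_word v w @ [?w, ?v], [] @ [?w, ?v]) \<in> ?c"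
    using vw e by (intro presentation_cong.relator) auto
  moreover have "([?v, ?w, ?v'] @ [?w', (w, \<not> False)] @ [?v], [?v, ?w, ?v'] @ [?v]) \<in> ?c"
    using vw by (intro presentation_cong.cancel) auto
  moreover have "([?v, ?w] @ [?v', (v, \<not> False)] @ [], [?v, ?w] @ []) \<in> ?c"
    using vw by (intro presentation_cong.cancel) auto
  ultimately have "([?v, ?w], [?w, ?v]) \<in> ?c"
    by (simp add: commutator_word_def) (blast intro: presentation_cong.sym presentation_cong.trans)
  then show ?thesis using vw by (simp add: raag_eq P.mult_P P.word_class_eq_iff)
qed

lemma additive_group: "group (add_monoid L)"
  by (rule L.a_group)

lemma cocycle_hom:
  assumes f: "f \<in> carrier (Z 1)"
  shows "(\<lambda>g. f [g]) \<in> hom P.P (add_monoid L)"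
  using cocycle_1_closed[OF f] cocycle_1_mult[OF f] by (auto simp: hom_def raag_eq)

lemma cocycle_eqI:
  assumes f: "f \<in> carrier (Z 1)" and f': "f' \<in> carrier (Z 1)"
    and eq: "\<And>v. v \<in> Vert \<Gamma> \<Longrightarrow> f [P.gen v] = f' [P.gen v]"
  shows "f = f'"
proof (rule cochain_eqI[OF cocycle_1_cochain[OF f] cocycle_1_cochain[OF f']])
  fix xs assume "xs \<in> tuples (raag \<Gamma>) 1"
  then obtain g where g: "g \<in> carrier (raag \<Gamma>)" "xs = [g]" by (rule tuples_1_cases)
  then show "f xs = f' xs"
    using P.hom_eqI[OF additive_group cocycle_hom[OF f] cocycle_hom[OF f'] eq] by (simp add: raag_eq)
qed

text \<open>The additive group of \<open>L\<close> is commutative, so it satisfies all relations whatever the values on the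
  generators.\<close>

lemma exists_cocycle:
  assumes \<phi>: "\<phi> \<in> Vert \<Gamma> \<rightarrow> carrier L"
  obtains f where "f \<in> carrier (Z 1)" "\<And>v. v \<in> Vert \<Gamma> \<Longrightarrow> f [P.gen v] = \<phi> v"
proof -
  have \<phi>': "\<phi> \<in> Vert \<Gamma> \<rightarrow> carrier (add_monoid L)" using \<phi> by simp
  have "word_eval (add_monoid L) \<phi> r = \<one>\<^bsub>add_monoid L\<^esub>" if rel: "r \<in> relators" for r
  proof -
    obtain v w where r: "r = commutator_word v w" "{v, w} \<in> Edge \<Gamma>" using rel by blast
    then have "\<phi> v \<in> carrier L" "\<phi> w \<in> carrier L" using Edge_subset[OF r(2)] \<phi> by auto
    then show ?thesis
      unfolding r(1) by (intro group.word_eval_commutator_word[OF additive_group]) (simp_all add: L.a_comm)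
  qed
  then obtain h where h: "h \<in> hom P.P (add_monoid L)" "\<And>v. v \<in> Vert \<Gamma> \<Longrightarrow> h (P.gen v) = \<phi> v"
    using P.exists_hom[OF additive_group \<phi>'] by blast
  let ?f = "\<lambda>xs\<in>tuples (raag \<Gamma>) 1. h (hd xs)"
  have fg: "?f [g] = h g" if "g \<in> carrier (raag \<Gamma>)" for g
    using that by (simp add: Cons_in_tuples_simps)
  have "?f \<in> carrier (C 1)"
    using h(1) by (intro function_cochain) (simp add: hom_def raag_eq)
  then have "?f \<in> carrier (Z 1)"
    using h(1) by (auto simp: cocycles_1_iff singleton_in_tuples hom_def simp flip: raag_eq simp del: One_nat_def)
  moreover have "?f [P.gen v] = \<phi> v" if "v \<in> Vert \<Gamma>" for v
    using fg[OF gen_closed[OF that]] h(2)[OF that] by simp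
  ultimately show ?thesis by (rule that)
qed

text \<open>The set \<open>X\<close> stands for an element of \<open>H\<^sup>1\<close>, a singleton of a character; its coordinates are the values on
  the generators.\<close>

definition gen_values :: "('v word set list \<Rightarrow> 'l) set \<Rightarrow> 'v \<Rightarrow> 'l" where
  "gen_values X v = the_elem X [P.gen v]"

lemma gen_values_coordinates: "coordinates L (cohomology L (raag \<Gamma>) 1) (Vert \<Gamma>) gen_values"
proof (intro coordinates.intro coordinates_axioms.intro cohomology_1_vectorspace)
  interpret Z1: vectorspace L "Z 1" by (rule cocycles_vectorspace)
  let ?H = "cohomology L (raag \<Gamma>) 1"
  show "finite (Vert \<Gamma>)" by (rule finite_Vert)
  have one: "[P.gen v] \<in> tuples (raag \<Gamma>) 1" if "v \<in> Vert \<Gamma>" for v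
    using gen_closed[OF that] by (simp add: Cons_in_tuples_simps)
  {
    fix x v assume "x \<in> carrier ?H" "v \<in> Vert \<Gamma>"
    then show "gen_values x v \<in> carrier L"
      unfolding cohomology_1_carrier using cocycle_1_closed gen_closed by (auto simp: gen_values_def)
  next
    fix x y v assume xy: "x \<in> carrier ?H" "y \<in> carrier ?H" and v: "v \<in> Vert \<Gamma>"
    then obtain a b where "a \<in> carrier (Z 1)" "b \<in> carrier (Z 1)" "x = {a}" "y = {b}"
      unfolding cohomology_1_carrier by blast
    then show "gen_values (x \<oplus>\<^bsub>?H\<^esub> y) v = gen_values x v \<oplus>\<^bsub>L\<^esub> gen_values y v"
      using one[OF v] by (simp add: gen_values_def cohomology_1_add cochains_simps del: One_nat_def)
  next
    fix c x v assume c: "c \<in> carrier L" and x: "x \<in> carrier ?H" and v: "v \<in> Vert \<Gamma>"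
    then obtain a where "a \<in> carrier (Z 1)" "x = {a}" unfolding cohomology_1_carrier by blast
    then show "gen_values (c \<odot>\<^bsub>?H\<^esub> x) v = c \<otimes>\<^bsub>L\<^esub> gen_values x v"
      using one[OF v] c by (simp add: gen_values_def cohomology_1_smult cochains_simps del: One_nat_def)
  next
    fix x assume x: "x \<in> carrier ?H" and z: "\<And>v. v \<in> Vert \<Gamma> \<Longrightarrow> gen_values x v = \<zero>\<^bsub>L\<^esub>"
    then obtain a where a: "a \<in> carrier (Z 1)" "x = {a}" unfolding cohomology_1_carrier by blast
    have "\<zero>\<^bsub>C 1\<^esub> \<in> carrier (Z 1)" using Z1.M.zero_closed by simp
    then have "a = \<zero>\<^bsub>C 1\<^esub>"
      using a z one by (intro cocycle_eqI) (auto simp: gen_values_def zero_cochain simp del: One_nat_def)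
    then show "x = \<zero>\<^bsub>?H\<^esub>" unfolding cohomology_1_zero a(2) by simp
  next
    fix \<phi> assume "\<phi> \<in> Vert \<Gamma> \<rightarrow> carrier L"
    then obtain f where f: "f \<in> carrier (Z 1)" "\<And>v. v \<in> Vert \<Gamma> \<Longrightarrow> f [P.gen v] = \<phi> v"
      by (rule exists_cocycle) blast
    then show "\<exists>x\<in>carrier ?H. \<forall>v\<in>Vert \<Gamma>. gen_values x v = \<phi> v"
      unfolding cohomology_1_carrier by (auto simp: gen_values_def)
  }
qed

text \<open>A primitive \<open>f\<close> of \<open>a \<smile> b\<close> forces the minors to vanish because \<open>f(gh) = f(hg)\<close> for commuting
  generators; vanishing minors yield a homomorphism to the Heisenberg group, and with it a primitive.\<close>

lemma cup_eq_zero_iff_minors: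
  assumes a: "a \<in> carrier (Z 1)" and b: "b \<in> carrier (Z 1)"
  shows "cup L (raag \<Gamma>) 1 1 {a} {b} = \<zero>\<^bsub>cohomology L (raag \<Gamma>) 2\<^esub> \<longleftrightarrow>
    (\<forall>v w. {v, w} \<in> Edge \<Gamma> \<longrightarrow>
      a [P.gen v] \<otimes>\<^bsub>L\<^esub> b [P.gen w] = a [P.gen w] \<otimes>\<^bsub>L\<^esub> b [P.gen v])"
  unfolding cup_eq_zero_iff[OF a b]
proof
  assume "\<exists>f\<in>carrier (C 1). \<forall>g\<in>carrier (raag \<Gamma>). \<forall>h\<in>carrier (raag \<Gamma>).
      f [g \<otimes>\<^bsub>raag \<Gamma>\<^esub> h] = f [g] \<oplus>\<^bsub>L\<^esub> f [h] \<ominus>\<^bsub>L\<^esub> a [g] \<otimes>\<^bsub>L\<^esub> b [h]"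
  then obtain f where f: "f \<in> carrier (C 1)" and
    eq: "\<And>g h. g \<in> carrier (raag \<Gamma>) \<Longrightarrow> h \<in> carrier (raag \<Gamma>) \<Longrightarrow>
      f [g \<otimes>\<^bsub>raag \<Gamma>\<^esub> h] = f [g] \<oplus>\<^bsub>L\<^esub> f [h] \<ominus>\<^bsub>L\<^esub> a [g] \<otimes>\<^bsub>L\<^esub> b [h]" by blast
  show "\<forall>v w. {v, w} \<in> Edge \<Gamma> \<longrightarrow>
      a [P.gen v] \<otimes>\<^bsub>L\<^esub> b [P.gen w] = a [P.gen w] \<otimes>\<^bsub>L\<^esub> b [P.gen v]"
  proof (intro allI impI)
    fix v w assume e: "{v, w} \<in> Edge \<Gamma>"
    let ?g = "P.gen v" and ?h = "P.gen w"
    let ?s = "f [?g] \<oplus>\<^bsub>L\<^esub> f [?h]" and ?p = "a [?g] \<otimes>\<^bsub>L\<^esub> b [?h]" and ?p' = "a [?h] \<otimes>\<^bsub>L\<^esub> b [?g]"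
    have gh: "?g \<in> carrier (raag \<Gamma>)" "?h \<in> carrier (raag \<Gamma>)"
      using Edge_subset[OF e] gen_closed by auto
    have cl: "f [?g] \<oplus>\<^bsub>L\<^esub> f [?h] \<in> carrier L" "a [?g] \<otimes>\<^bsub>L\<^esub> b [?h] \<in> carrier L" "a [?h] \<otimes>\<^bsub>L\<^esub> b [?g] \<in> carrier L"
      and comm: "f [?h] \<oplus>\<^bsub>L\<^esub> f [?g] = f [?g] \<oplus>\<^bsub>L\<^esub> f [?h]"
      using gh cochain1_closed[OF f] cocycle_1_closed[OF a] cocycle_1_closed[OF b] by (auto simp: L.a_comm)
    have "f [?g] \<oplus>\<^bsub>L\<^esub> f [?h] \<ominus>\<^bsub>L\<^esub> a [?g] \<otimes>\<^bsub>L\<^esub> b [?h] = f [?g] \<oplus>\<^bsub>L\<^esub> f [?h] \<ominus>\<^bsub>L\<^esub> a [?h] \<otimes>\<^bsub>L\<^esub> b [?g]"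
      using eq[OF gh] eq[OF gh(2,1)] adjacent_gens_commute[OF e] comm by simp
    \<comment> \<open>cancel the common summand \<open>f [?g] \<oplus>\<^bsub>L\<^esub> f [?h]\<close>, then the sign\<close>
    then have "\<ominus>\<^bsub>L\<^esub> (\<ominus>\<^bsub>L\<^esub> ?s \<oplus>\<^bsub>L\<^esub> (?s \<ominus>\<^bsub>L\<^esub> ?p)) = \<ominus>\<^bsub>L\<^esub> (\<ominus>\<^bsub>L\<^esub> ?s \<oplus>\<^bsub>L\<^esub> (?s \<ominus>\<^bsub>L\<^esub> ?p'))" by simp
    moreover have "\<ominus>\<^bsub>L\<^esub> (\<ominus>\<^bsub>L\<^esub> x \<oplus>\<^bsub>L\<^esub> (x \<ominus>\<^bsub>L\<^esub> y)) = y" if "x \<in> carrier L" "y \<in> carrier L" for x y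
      using that by (simp add: L.minus_eq L.r_neg1)
    ultimately show "?p = ?p'" using cl by simp
  qed
next
  assume minors: "\<forall>v w. {v, w} \<in> Edge \<Gamma> \<longrightarrow>
      a [P.gen v] \<otimes>\<^bsub>L\<^esub> b [P.gen w] = a [P.gen w] \<otimes>\<^bsub>L\<^esub> b [P.gen v]"
  let ?H = "heisenberg L"
  have H: "group ?H" by (rule L.group_heisenberg)
  let ?\<phi> = "\<lambda>v. (a [P.gen v], b [P.gen v], \<zero>\<^bsub>L\<^esub>)"
  have \<phi>: "?\<phi> \<in> Vert \<Gamma> \<rightarrow> carrier ?H"
    using cocycle_1_closed a b gen_closed by (auto simp: heisenberg_def)
  have "word_eval ?H ?\<phi> r = \<one>\<^bsub>?H\<^esub>" if rel: "r \<in> relators" for r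
  proof -
    obtain v w where r: "r = commutator_word v w" "{v, w} \<in> Edge \<Gamma>" using rel by blast
    then have vw: "v \<in> Vert \<Gamma>" "w \<in> Vert \<Gamma>" using Edge_subset[OF r(2)] by auto
    then have cl: "a [P.gen v] \<in> carrier L" "a [P.gen w] \<in> carrier L" "b [P.gen v] \<in> carrier L" "b [P.gen w] \<in> carrier L"
      using cocycle_1_closed a b gen_closed by blast+
    \<comment> \<open>elements \<open>(x, y, 0)\<close> and \<open>(x', y', 0)\<close> commute iff \<open>x y' = x' y\<close>\<close>
    have "a [P.gen v] \<otimes>\<^bsub>L\<^esub> b [P.gen w] = a [P.gen w] \<otimes>\<^bsub>L\<^esub> b [P.gen v]" using minors r(2) by blast
    then have "?\<phi> v \<otimes>\<^bsub>?H\<^esub> ?\<phi> w = ?\<phi> w \<otimes>\<^bsub>?H\<^esub> ?\<phi> v"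
      using cl by (simp add: heisenberg_def L.a_comm)
    then show ?thesis
      unfolding r(1) using \<phi> vw by (intro group.word_eval_commutator_word[OF H]) auto
  qed
  then obtain h where h: "h \<in> hom P.P ?H" "\<And>v. v \<in> Vert \<Gamma> \<Longrightarrow> h (P.gen v) = ?\<phi> v"
    using P.exists_hom[OF H \<phi>] by blast
  have hcl: "fst (h g) \<in> carrier L" "fst (snd (h g)) \<in> carrier L" "snd (snd (h g)) \<in> carrier L"
    if "g \<in> carrier P.P" for g
  proof -
    have "h g \<in> carrier ?H" using h(1) that by (auto simp: hom_def)
    then show "fst (h g) \<in> carrier L" "fst (snd (h g)) \<in> carrier L" "snd (snd (h g)) \<in> carrier L"
      by (auto simp: heisenberg_def)
  qed
  have hm: "h (g \<otimes>\<^bsub>P.P\<^esub> k) = (fst (h g) \<oplus>\<^bsub>L\<^esub> fst (h k), fst (snd (h g)) \<oplus>\<^bsub>L\<^esub> fst (snd (h k)),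
      snd (snd (h g)) \<oplus>\<^bsub>L\<^esub> snd (snd (h k)) \<ominus>\<^bsub>L\<^esub> fst (h g) \<otimes>\<^bsub>L\<^esub> fst (snd (h k)))"
    if "g \<in> carrier P.P" "k \<in> carrier P.P" for g k
  proof -
    have "h (g \<otimes>\<^bsub>P.P\<^esub> k) = h g \<otimes>\<^bsub>?H\<^esub> h k" using h(1) that by (simp add: hom_def)
    then show ?thesis by (simp add: heisenberg_def case_prod_beta)
  qed
  \<comment> \<open>the first two coordinates are characters, hence determined by the generators\<close>
  have ha: "fst (h g) = a [g]" if "g \<in> carrier P.P" for g
  proof (rule P.hom_eqI[OF additive_group _ cocycle_hom[OF a] _ that])
    show "(\<lambda>g. fst (h g)) \<in> hom P.P (add_monoid L)" using hcl hm by (auto simp: hom_def)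
  qed (simp add: h(2))
  have hb: "fst (snd (h g)) = b [g]" if "g \<in> carrier P.P" for g
  proof (rule P.hom_eqI[OF additive_group _ cocycle_hom[OF b] _ that])
    show "(\<lambda>g. fst (snd (h g))) \<in> hom P.P (add_monoid L)" using hcl hm by (auto simp: hom_def)
  qed (simp add: h(2))
  let ?f = "\<lambda>xs\<in>tuples (raag \<Gamma>) 1. snd (snd (h (hd xs)))"
  have fg: "?f [g] = snd (snd (h g))" if "g \<in> carrier (raag \<Gamma>)" for g
    using that by (simp add: Cons_in_tuples_simps)
  show "\<exists>f\<in>carrier (C 1). \<forall>g\<in>carrier (raag \<Gamma>). \<forall>k\<in>carrier (raag \<Gamma>).
      f [g \<otimes>\<^bsub>raag \<Gamma>\<^esub> k] = f [g] \<oplus>\<^bsub>L\<^esub> f [k] \<ominus>\<^bsub>L\<^esub> a [g] \<otimes>\<^bsub>L\<^esub> b [k]"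
  proof (intro bexI ballI)
    show "?f \<in> carrier (C 1)"
      using hcl by (intro function_cochain) (simp add: raag_eq)
    fix g k assume gk: "g \<in> carrier (raag \<Gamma>)" "k \<in> carrier (raag \<Gamma>)"
    then have gk': "g \<in> carrier P.P" "k \<in> carrier P.P" by (simp_all add: raag_eq)
    have "snd (snd (h (g \<otimes>\<^bsub>raag \<Gamma>\<^esub> k)))
        = snd (snd (h g)) \<oplus>\<^bsub>L\<^esub> snd (snd (h k)) \<ominus>\<^bsub>L\<^esub> a [g] \<otimes>\<^bsub>L\<^esub> b [k]"
      unfolding raag_eq hm[OF gk'] ha[OF gk'(1)] hb[OF gk'(2)] by simp
    then show "?f [g \<otimes>\<^bsub>raag \<Gamma>\<^esub> k] = ?f [g] \<oplus>\<^bsub>L\<^esub> ?f [k] \<ominus>\<^bsub>L\<^esub> a [g] \<otimes>\<^bsub>L\<^esub> b [k]"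
      unfolding fg[OF gk(1)] fg[OF gk(2)] fg[OF G.m_closed[OF gk]] .
  qed
qed

end

theorem proposition1p1:
  fixes L :: "('l, 'm) ring_scheme" and \<Gamma> :: "'v simplicial_graph"
  assumes "field L" and "fin_simplicial_graph \<Gamma>"
  shows "graph_cheeger \<Gamma> =
    pairing.cheeger L (cohomology L (raag \<Gamma>) 1) (cohomology L (raag \<Gamma>) 2) (cup L (raag \<Gamma>) 1 1)"
proof -
  interpret raag_cohomology L \<Gamma>
    using assms by (simp add: raag_cohomology_def)
  interpret coordinates L "cohomology L (raag \<Gamma>) 1" "Vert \<Gamma>" gen_values
    by (rule gen_values_coordinates)
  have "edge_minor_pairing L (cohomology L (raag \<Gamma>) 1) (cohomology L (raag \<Gamma>) 2) (cup L (raag \<Gamma>) 1 1)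
    \<Gamma> gen_values"
  proof (intro edge_minor_pairing.intro edge_minor_pairing_axioms.intro
      cup_pairing[OF finite_dim] gen_values_coordinates assms(2))
    fix x y assume "x \<in> carrier (cohomology L (raag \<Gamma>) 1)" "y \<in> carrier (cohomology L (raag \<Gamma>) 1)"
    then obtain a b where ab: "a \<in> carrier (Z 1)" "b \<in> carrier (Z 1)" "x = {a}" "y = {b}"
      unfolding cohomology_1_carrier by blast
    then show "cup L (raag \<Gamma>) 1 1 x y = \<zero>\<^bsub>cohomology L (raag \<Gamma>) 2\<^esub> \<longleftrightarrow>
      (\<forall>v w. {v, w} \<in> Edge \<Gamma> \<longrightarrow> gen_values x v \<otimes>\<^bsub>L\<^esub> gen_values y w = gen_values x w \<otimes>\<^bsub>L\<^esub> gen_values y v)"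
      using cup_eq_zero_iff_minors[OF ab(1,2)] by (simp add: gen_values_def)
  qed
  then show ?thesis by (rule edge_minor_pairing.cheeger_eq_graph_cheeger[symmetric])
qed

end
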